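(* Let $X,X_1,X_2,\ldots$ be i.i.d. random variables with $X\in DAN$, and for each $n\ge1$ let $(w_1^{(n)},\ldots,w_n^{(n)})$ have the multinomial distribution of size $m_n$ with probabilities $(\frac1n,\ldots,\frac1n)$, independent of the data (Efron's bootstrap). If $n,m_n\to\infty$ so that, for an arbitrary $\varepsilon>0$, we have $\frac{m_n}{n}\ge\varepsilon>0$, then, for all $t\in\mathbb R$, $$P_{w|X}\big(T^{**}_{m_n,S_n}\le t\big)\to P(Z\le t)\ \text{ in probability-}P_X,$$ where $Z$ is a standard normal random variable.
   Context: $X\in DAN$ means that $X$ is in the domain of attraction of the normal law (possibly with infinite variance): there are constants $a_n\in\mathbb R$, $b_n>0$ with $b_n^{-1}(\sum_{i=1}^nX_i-a_n)\to N(0,1)$ in distribution. The condition on $m_n$ means: there is some fixed (arbitrary) constant $\varepsilon>0$ with $m_n/n\ge\varepsilon$. The data live on $(\Omega_X,\mathcal F_X,P_X)$, the weights on $(\Omega_w,\mathcal F_w,P_w)$, jointly on the product space; $P_{w|X}(\cdot)$ denotes conditional probability given $\sigma(X_1,\ldots,X_n)$. Put $\bar X_n=\frac1n\sum_{i=1}^nX_i$, $S_n^2=\frac1n\sum_{i=1}^n(X_i-\bar X_n)^2$, and $$T^{**}_{m_n,S_n}=\frac{\sum_{i=1}^n\big(\frac{w_i^{(n)}}{m_n}-\frac1n\big)X_i}{S_n/\sqrt{m_n}}.$$ *)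

theory Defs
  imports "HOL-Probability.Probability"
begin

text \<open>Samples are indexed from 0: the first \<open>n\<close> observations are \<open>X i\<close> for \<open>i < n\<close>.\<close>

definition iid_seq :: "'a measure \<Rightarrow> (nat \<Rightarrow> 'a \<Rightarrow> real) \<Rightarrow> bool" where
  "iid_seq M X \<longleftrightarrow> prob_space.indep_vars M (\<lambda>_. borel) X UNIV \<and>
     (\<forall>i. distr M borel (X i) = distr M borel (X 0))"

text \<open>Domain of attraction of the normal law, formulated through the partial sums of a sequence
  of i.i.d. copies; no moment assumption is made.\<close>

definition DAN :: "'a measure \<Rightarrow> (nat \<Rightarrow> 'a \<Rightarrow> real) \<Rightarrow> bool" where
  "DAN M X \<longleftrightarrow> (\<exists>(a :: nat \<Rightarrow> real) (b :: nat \<Rightarrow> real). (\<forall>n. b n > 0) \<and>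
     weak_conv_m (\<lambda>n. distr M borel (\<lambda>\<omega>. ((\<Sum>i<n. X i \<omega>) - a n) / b n))
       std_normal_distribution)"

definition multinomial_prob :: "nat \<Rightarrow> nat \<Rightarrow> (nat \<Rightarrow> real) \<Rightarrow> (nat \<Rightarrow> nat) \<Rightarrow> real" where
  "multinomial_prob n m p k =
     (if (\<Sum>i<n. k i) = m
      then fact m / (\<Prod>i<n. fact (k i)) * (\<Prod>i<n. p i ^ k i)
      else 0)"

definition multinomial_distributed ::
    "'a measure \<Rightarrow> nat \<Rightarrow> nat \<Rightarrow> (nat \<Rightarrow> real) \<Rightarrow> (nat \<Rightarrow> 'a \<Rightarrow> nat) \<Rightarrow> bool" where
  "multinomial_distributed M n m p W \<longleftrightarrow>
     (\<forall>i<n. W i \<in> measurable M (count_space UNIV)) \<and>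
     (\<forall>k. measure M {\<omega> \<in> space M. \<forall>i<n. W i \<omega> = k i} = multinomial_prob n m p k)"

definition sample_mean :: "nat \<Rightarrow> (nat \<Rightarrow> real) \<Rightarrow> real" where
  "sample_mean n x = (\<Sum>i<n. x i) / real n"

definition sample_sd :: "nat \<Rightarrow> (nat \<Rightarrow> real) \<Rightarrow> real" where
  "sample_sd n x = sqrt ((\<Sum>i<n. (x i - sample_mean n x)\<^sup>2) / real n)"

text \<open>The studentized bootstrap mean for data \<open>x\<close>, resample size \<open>m\<close> and weights \<open>k\<close>. It takes the
  value 0 if \<open>sample_sd n x = 0\<close>, by the convention for division by zero.\<close>

definition boot_T :: "nat \<Rightarrow> nat \<Rightarrow> (nat \<Rightarrow> real) \<Rightarrow> (nat \<Rightarrow> nat) \<Rightarrow> real" where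
  "boot_T n m x k =
     (\<Sum>i<n. (real (k i) / real m - 1 / real n) * x i) / (sample_sd n x / sqrt (real m))"

text \<open>The \<open>\<sigma>\<close>-algebra generated by the first \<open>n\<close> random variables \<open>Y i\<close> on \<open>M\<close>; as an argument of
  \<open>real_cond_exp\<close> only its measurable sets matter.\<close>

definition sigma_first :: "'a measure \<Rightarrow> (nat \<Rightarrow> 'a \<Rightarrow> real) \<Rightarrow> nat \<Rightarrow> 'a measure" where
  "sigma_first M Y n =
     vimage_algebra (space M) (\<lambda>\<omega>. \<lambda>i\<in>{..<n}. Y i \<omega>) (Pi\<^sub>M {..<n} (\<lambda>_. borel))"

definition cond_prob_given :: "'a measure \<Rightarrow> 'a measure \<Rightarrow> 'a set \<Rightarrow> 'a \<Rightarrow> real" where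
  "cond_prob_given M F A = real_cond_exp M F (indicator A)"

text \<open>The conditional probability of \<open>T \<le> t\<close> given the first \<open>n\<close> observations, as a random variable
  on the product of the data space and the weight space.\<close>

definition boot_cond_prob ::
    "'x measure \<Rightarrow> 'w measure \<Rightarrow> (nat \<Rightarrow> 'x \<Rightarrow> real) \<Rightarrow> (nat \<Rightarrow> nat \<Rightarrow> 'w \<Rightarrow> nat) \<Rightarrow> (nat \<Rightarrow> nat) \<Rightarrow>
     real \<Rightarrow> nat \<Rightarrow> 'x \<times> 'w \<Rightarrow> real" where
  "boot_cond_prob PX Pw X w m t n =
     cond_prob_given (PX \<Otimes>\<^sub>M Pw) (sigma_first (PX \<Otimes>\<^sub>M Pw) (\<lambda>i z. X i (fst z)) n)
       {z \<in> space (PX \<Otimes>\<^sub>M Pw). boot_T n (m n) (\<lambda>i. X i (fst z)) (\<lambda>i. w n i (snd z)) \<le> t}"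

definition conv_in_prob :: "'a measure \<Rightarrow> (nat \<Rightarrow> 'a \<Rightarrow> real) \<Rightarrow> real \<Rightarrow> bool" where
  "conv_in_prob M Y c \<longleftrightarrow> (\<forall>n. Y n \<in> borel_measurable M) \<and>
     (\<forall>\<delta>>0. (\<lambda>n. measure M {\<omega> \<in> space M. \<bar>Y n \<omega> - c\<bar> > \<delta>}) \<longlonglongrightarrow> 0)"

text \<open>A random variable on the product space that is measurable with respect to the \<open>\<sigma>\<close>-algebra
  of the data does not depend on the second coordinate. Convergence in probability with respect to
  the law of the data alone is therefore expressed by fixing that coordinate, arbitrarily.\<close>

definition conv_in_prob_fst ::
    "'x measure \<Rightarrow> 'w measure \<Rightarrow> (nat \<Rightarrow> 'x \<times> 'w \<Rightarrow> real) \<Rightarrow> real \<Rightarrow> bool" where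
  "conv_in_prob_fst PX Pw Y c \<longleftrightarrow> (\<forall>v\<in>space Pw. conv_in_prob PX (\<lambda>n u. Y n (u, v)) c)"

end

theory Submission
  imports Defs
begin

text \<open>
  Given the data \<open>x\<close>, the bootstrap statistic has the law of a sum of \<open>m\<close> independent draws from the
  uniform distribution on the \<open>n\<close> numbers \<open>c i = (x i - mean) / (sd * sqrt m)\<close>, which have mean \<open>0\<close> and
  second moment \<open>1 / m\<close>. By the multinomial theorem its characteristic function is the \<open>m\<close>-th power of the
  mean of \<open>exp (\<i> s c)\<close>, and a Taylor expansion shows that it differs from \<open>(1 - s\<^sup>2 / (2 m)) ^ m\<close> by at most
  a constant times \<open>max \<bar>c i\<bar>\<close>. Levy's continuity theorem then gives a central limit theorem that is
  uniform over all data sets whose largest deviation from the mean is small compared with \<open>sd * sqrt m\<close>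
  (\<open>boot_T_clt_uniform\<close>). Since \<open>m / n \<ge> \<epsilon>\<close>, smallness compared with \<open>sd * sqrt n\<close> is enough.

  So all that is needed from the domain of attraction is that
  \<open>max (x i - mean)\<^sup>2 / \<Sum> (x i - mean)\<^sup>2\<close> tends to \<open>0\<close> in probability
  (\<open>deviations_negligible\<close>). This is obtained from characteristic functions alone, without slow variation of
  truncated moments. Let \<open>Y\<close> be the difference of two observations. Passing to the modulus of the
  characteristic function of the normalised sums removes the centering, and leaves
  \<open>n E (1 - cos (s Y / b n)) \<longlonglongrightarrow> s\<^sup>2\<close> for each \<open>s\<close> (\<open>DAN_cos_difference\<close>).
  Because \<open>2 (1 - cos u)\<^sup>2 = 4 (1 - cos u) - (1 - cos (2 u))\<close> and the limit is quadratic in \<open>s\<close>,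
  the second moments vanish: \<open>n E (1 - cos (s Y / b n))\<^sup>2 \<longlonglongrightarrow> 0\<close>. This has two consequences.

  \<^item> Averaging over \<open>s\<close> bounds \<open>n P (\<bar>Y\<bar> > \<delta> b n)\<close>, which therefore tends to \<open>0\<close>; a union bound
    controls the range of the sample (\<open>tail_negligible\<close>).

  \<^item> By Chebyshev's inequality the sum of \<open>1 - cos (Y i / b n)\<close> over the \<open>n div 2\<close> disjoint pairs of
    observations concentrates near \<open>1 / 2\<close>; as \<open>1 - cos u \<le> u\<^sup>2 / 2\<close>, this bounds the sample variance from
    below.

  Finally the conditional probability given the data is identified with the probability over the weights
  with the data held fixed, by Fubini's theorem (\<open>boot_cond_prob_eq\<close>).
\<close>

section \<open>Multinomial sums\<close>

text \<open>The bound \<open>m\<close> on the parts follows from their sum; it makes the set visibly finite. Extensionality makes a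
  composition a single function, so that it can be compared with a restricted weight vector.\<close>
definition compositions :: "nat \<Rightarrow> nat \<Rightarrow> (nat \<Rightarrow> nat) set" where
  "compositions n m = {k \<in> {..<n} \<rightarrow>\<^sub>E {..m}. (\<Sum>i<n. k i) = m}"

lemma finite_compositions [simp]: "finite (compositions n m)"
  unfolding compositions_def by (rule finite_subset[OF _ finite_PiE[of "{..<n}" "\<lambda>_. {..m}"]]) auto

lemma compositions_iff:
  "k \<in> compositions n m \<longleftrightarrow> k \<in> extensional {..<n} \<and> (\<Sum>i<n. k i) = m"
proof -
  have "k i \<le> (\<Sum>i<n. k i)" if "i < n" for i
    by (rule member_le_sum) (use that in auto)
  then show ?thesis
    by (auto simp: compositions_def PiE_iff)
qed

text \<open>The last part \<open>j\<close> of a composition is free, and the others compose \<open>m - j\<close>.\<close>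
lemma compositions_Suc:
  "bij_betw (\<lambda>(j, k). k(n := j)) (SIGMA j:{..m}. compositions n (m - j)) (compositions (Suc n) m)"
proof (rule bij_betw_byWitness[where f' = "\<lambda>k. (k n, restrict k {..<n})"])
  have upd: "restrict (k(n := j)) {..<n} = k" if "k \<in> extensional {..<n}" for k and j :: nat
    using that by (intro ext) (simp add: restrict_def extensional_def)
  show "\<forall>a\<in>SIGMA j:{..m}. compositions n (m - j).
      (\<lambda>k. (k n, restrict k {..<n})) ((\<lambda>(j, k). k(n := j)) a) = a"
    by (clarify, unfold compositions_iff) (use upd in auto)
  have res: "(restrict k {..<n})(n := k n) = k" if "k \<in> extensional {..<Suc n}" for k :: "nat \<Rightarrow> nat"
    using that by (intro ext) (simp add: restrict_def extensional_def)
  show "\<forall>a'\<in>compositions (Suc n) m.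
      (\<lambda>(j, k). k(n := j)) ((\<lambda>k. (k n, restrict k {..<n})) a') = a'"
    by (clarify, unfold compositions_iff) (use res in auto)
  have "k(n := j) \<in> compositions (Suc n) m" if "k \<in> compositions n (m - j)" "j \<le> m" for k j
  proof -
    have "(\<Sum>i<n. (k(n := j)) i) = (\<Sum>i<n. k i)"
      by (rule sum.cong) simp_all
    then have "(\<Sum>i<Suc n. (k(n := j)) i) = m" 
      using that by (simp add: compositions_iff)
    then show ?thesis using that by (simp add: compositions_iff extensional_def)
  qed
  then show "(\<lambda>(j, k). k(n := j)) ` (SIGMA j:{..m}. compositions n (m - j)) \<subseteq> compositions (Suc n) m"
    by auto
  show "(\<lambda>k. (k n, restrict k {..<n})) ` compositions (Suc n) m \<subseteq> (SIGMA j:{..m}. compositions n (m - j))"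
    by (auto simp: compositions_iff)
qed

text \<open>The multinomial theorem divided by \<open>fact m\<close>. In this form the weights are products over the
  coordinates, so that splitting off the last coordinate leaves the binomial theorem.\<close>
lemma sum_compositions_exp:
  fixes z :: "nat \<Rightarrow> 'a::field_char_0"
  shows "(\<Sum>k\<in>compositions n m. \<Prod>i<n. z i ^ k i / fact (k i)) = (\<Sum>i<n. z i) ^ m / fact m"
proof (induction n arbitrary: m)
  case 0
  have "compositions 0 m = (if m = 0 then {\<lambda>_. undefined} else {})"
    by (auto simp: compositions_def)
  then show ?case by (cases m) auto
next
  case (Suc n)
  have "(\<Sum>k\<in>compositions (Suc n) m. \<Prod>i<Suc n. z i ^ k i / fact (k i)) =
      (\<Sum>(j, k)\<in>(SIGMA j:{..m}. compositions n (m - j)).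
         \<Prod>i<Suc n. z i ^ (k(n := j)) i / fact ((k(n := j)) i))"
    by (subst sum.reindex_bij_betw[OF compositions_Suc, symmetric]) (simp add: case_prod_unfold)
  also have "\<dots> = (\<Sum>(j, k)\<in>(SIGMA j:{..m}. compositions n (m - j)).
         (\<Prod>i<n. z i ^ k i / fact (k i)) * (z n ^ j / fact j))"
  proof (intro sum.cong refl, clarify)
    fix j and k :: "nat \<Rightarrow> nat"
    have "(\<Prod>i<n. z i ^ (k(n := j)) i / fact ((k(n := j)) i)) = (\<Prod>i<n. z i ^ k i / fact (k i))"
      by (rule prod.cong) auto
    then show "(\<Prod>i<Suc n. z i ^ (k(n := j)) i / fact ((k(n := j)) i)) =
        (\<Prod>i<n. z i ^ k i / fact (k i)) * (z n ^ j / fact j)" by simp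
  qed
  also have "\<dots> = (\<Sum>j\<le>m. \<Sum>k\<in>compositions n (m - j).
         (\<Prod>i<n. z i ^ k i / fact (k i)) * (z n ^ j / fact j))"
    by (subst sum.Sigma) auto
  also have "\<dots> = (\<Sum>j\<le>m. (\<Sum>i<n. z i) ^ (m - j) / fact (m - j) * (z n ^ j / fact j))"
    by (simp only: sum_distrib_right[symmetric] Suc)
  also have "\<dots> = (\<Sum>j\<le>m. of_nat (m choose j) * z n ^ j * (\<Sum>i<n. z i) ^ (m - j)) / fact m"
    by (auto simp: sum_divide_distrib binomial_fact field_simps intro!: sum.cong)
  also have "\<dots> = (\<Sum>i<Suc n. z i) ^ m / fact m"
    by (simp add: binomial_ring add.commute)
  finally show ?case .
qed

lemma multinomial_theorem:
  fixes z :: "nat \<Rightarrow> 'a::{field_char_0, real_normed_field}"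
  shows "(\<Sum>k\<in>compositions n m. of_real (multinomial_prob n m p k) * (\<Prod>i<n. z i ^ k i)) =
    (\<Sum>i<n. of_real (p i) * z i) ^ m"
proof -
  have "(\<Sum>k\<in>compositions n m. of_real (multinomial_prob n m p k) * (\<Prod>i<n. z i ^ k i)) =
      (\<Sum>k\<in>compositions n m. fact m * (\<Prod>i<n. (of_real (p i) * z i) ^ k i / fact (k i)))"
    by (intro sum.cong refl)
       (simp add: multinomial_prob_def compositions_def prod_dividef prod.distrib power_mult_distrib)
  also have "\<dots> = (\<Sum>i<n. of_real (p i) * z i) ^ m"
    by (simp add: sum_distrib_left[symmetric] sum_compositions_exp)
  finally show ?thesis .
qed

context prob_space
begin

text \<open>The multinomial probabilities of the finitely many compositions already add up to \<open>1\<close>, so the law of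
  the weight vector is concentrated on them and all expectations are finite sums.\<close>
lemma multinomial_sum_eq_expectation:
  assumes W: "multinomial_distributed M n m p W" and p: "(\<Sum>i<n. p i) = 1"
  shows "AE \<omega> in M. restrict (\<lambda>i. W i \<omega>) {..<n} \<in> compositions n m"
    and "(\<integral>\<omega>. g (restrict (\<lambda>i. W i \<omega>) {..<n}) \<partial>M) =
      (\<Sum>k\<in>compositions n m. multinomial_prob n m p k *\<^sub>R (g k :: 'b::{banach, second_countable_topology}))"
proof -
  define R where "R \<omega> = restrict (\<lambda>i. W i \<omega>) {..<n}" for \<omega>
  define E where "E k = {\<omega> \<in> space M. \<forall>i<n. W i \<omega> = k i}" for k
  have [measurable]: "W i \<in> measurable M (count_space UNIV)" if "i < n" for i
    using W that by (auto simp: multinomial_distributed_def)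
  have E_sets [measurable]: "E k \<in> sets M" for k
    unfolding E_def by measurable
  have prob_E: "prob (E k) = multinomial_prob n m p k" for k
    using W by (simp add: multinomial_distributed_def E_def)
  have E_iff: "\<omega> \<in> E k \<longleftrightarrow> R \<omega> = k" if "k \<in> compositions n m" "\<omega> \<in> space M" for k \<omega>
    using that by (auto simp: E_def R_def compositions_def PiE_def extensional_def fun_eq_iff restrict_def)
  have "prob (\<Union>k\<in>compositions n m. E k) = (\<Sum>k\<in>compositions n m. prob (E k))"
  proof (rule finite_measure_finite_Union)
    have "E k \<inter> E k' = {}" if "k \<in> compositions n m" "k' \<in> compositions n m" "k \<noteq> k'" for k k'
    proof -
      have "\<omega> \<in> space M" if "\<omega> \<in> E k" for \<omega> using that by (simp add: E_def)
      with that show ?thesis by (metis E_iff disjoint_iff)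
    qed
    then show "disjoint_family_on E (compositions n m)" by (simp add: disjoint_family_on_def)
  qed auto
  also have "\<dots> = 1"
    using multinomial_theorem[of n m p "\<lambda>_. 1::real"] p by (simp add: prob_E)
  finally have "AE \<omega> in M. \<omega> \<in> (\<Union>k\<in>compositions n m. E k)"
    by (subst (asm) prob_eq_1) auto
  then have AE_R: "AE \<omega> in M. R \<omega> \<in> compositions n m"
    using AE_space by eventually_elim (auto simp: E_iff)
  then show "AE \<omega> in M. restrict (\<lambda>i. W i \<omega>) {..<n} \<in> compositions n m"
    by (simp add: R_def)
  have "(\<integral>\<omega>. g (R \<omega>) \<partial>M) = (\<integral>\<omega>. (\<Sum>k\<in>compositions n m. indicator (E k) \<omega> *\<^sub>R g k) \<partial>M)"
  proof (rule integral_cong_AE)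
    show "AE \<omega> in M. g (R \<omega>) = (\<Sum>k\<in>compositions n m. indicator (E k) \<omega> *\<^sub>R g k)"
      using AE_R AE_space
    proof eventually_elim
      case (elim \<omega>)
      have "(\<Sum>k\<in>compositions n m. indicator (E k) \<omega> *\<^sub>R g k) =
          (\<Sum>k\<in>compositions n m. if k = R \<omega> then g k else 0)"
        using elim by (intro sum.cong) (auto simp: E_iff indicator_def)
      then show ?case using elim by (simp add: R_def)
    qed
    show "(\<lambda>\<omega>. g (R \<omega>)) \<in> borel_measurable M"
    proof -
      have "R \<in> measurable M (Pi\<^sub>M {..<n} (\<lambda>_. count_space UNIV))"
        unfolding R_def by measurable
      moreover have "g \<in> borel_measurable (Pi\<^sub>M {..<n} (\<lambda>_. count_space (UNIV::nat set)))"
      proof (rule measurableI)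
        fix A :: "'b set"
        \<comment> \<open>Every function on the space of weight vectors is measurable, because that space is countable.\<close>
        have "countable ({..<n} \<rightarrow>\<^sub>E (UNIV::nat set))"
          by (intro countable_PiE) auto
        then have c: "countable (g -` A \<inter> ({..<n} \<rightarrow>\<^sub>E UNIV))"
          by (rule countable_subset[rotated]) auto
        have "{k} \<in> sets (Pi\<^sub>M {..<n} (\<lambda>_. count_space (UNIV::nat set)))"
          if "k \<in> {..<n} \<rightarrow>\<^sub>E UNIV" for k
        proof -
          have "(\<Pi>\<^sub>E i\<in>{..<n}. {k i}) = {k}"
            using that by (intro PiE_singleton) (simp add: PiE_def)
          then show ?thesis
            using sets_PiM_I_finite[of "{..<n}" "\<lambda>i. {k i}" "\<lambda>_. count_space (UNIV::nat set)"] by simp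
        qed
        then have "g -` A \<inter> ({..<n} \<rightarrow>\<^sub>E UNIV) \<in> sets (Pi\<^sub>M {..<n} (\<lambda>_. count_space (UNIV::nat set)))"
          by (rule sets.countable[OF _ c]) auto
        then show "g -` A \<inter> space (Pi\<^sub>M {..<n} (\<lambda>_. count_space (UNIV::nat set)))
            \<in> sets (Pi\<^sub>M {..<n} (\<lambda>_. count_space (UNIV::nat set)))"
          by (simp add: space_PiM)
      qed auto
      ultimately show ?thesis by (rule measurable_compose)
    qed
    show "(\<lambda>\<omega>. \<Sum>k\<in>compositions n m. indicator (E k) \<omega> *\<^sub>R g k) \<in> borel_measurable M"
      by measurable
  qed
  also have "\<dots> = (\<Sum>k\<in>compositions n m. multinomial_prob n m p k *\<^sub>R g k)"
  proof (subst Bochner_Integration.integral_sum)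
    show "integrable M (\<lambda>\<omega>. indicator (E k) \<omega> *\<^sub>R g k)" for k
      using E_sets[of k] by (intro integrable_scaleR_left integrable_real_indicator) (simp_all add: emeasure_eq_measure)
    show "(\<Sum>k\<in>compositions n m. \<integral>\<omega>. indicator (E k) \<omega> *\<^sub>R g k \<partial>M) =
        (\<Sum>k\<in>compositions n m. multinomial_prob n m p k *\<^sub>R g k)"
    proof (rule sum.cong[OF refl])
      fix k
      have "(\<integral>\<omega>. indicator (E k) \<omega> *\<^sub>R g k \<partial>M) = prob (E k \<inter> space M) *\<^sub>R g k"
        by (subst integral_scaleR_left) (simp_all add: emeasure_eq_measure)
      then show "(\<integral>\<omega>. indicator (E k) \<omega> *\<^sub>R g k \<partial>M) = multinomial_prob n m p k *\<^sub>R g k"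
        by (simp add: prob_E)
    qed
  qed
  finally show "(\<integral>\<omega>. g (restrict (\<lambda>i. W i \<omega>) {..<n}) \<partial>M) =
      (\<Sum>k\<in>compositions n m. multinomial_prob n m p k *\<^sub>R g k)"
    by (simp add: R_def)
qed

end

section \<open>The bootstrap central limit theorem for given data\<close>

lemma boot_T_restrict: "boot_T n m x (restrict k {..<n}) = boot_T n m x k"
  unfolding boot_T_def by (intro arg_cong2[where f="(/)"] sum.cong) auto

text \<open>Replacing \<open>x\<close> by its deviations from the mean changes nothing because the weights add up to \<open>m\<close>. Division
  by zero makes the identity hold also for constant data.\<close>
lemma boot_T_eq_weighted_sum:
  assumes "(\<Sum>i<n. k i) = m" "m > 0" "n > 0"
  shows "boot_T n m x k =
    (\<Sum>i<n. real (k i) * ((x i - sample_mean n x) / (sample_sd n x * sqrt (real m))))"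
proof -
  define \<mu> where "\<mu> = sample_mean n x"
  have m: "(\<Sum>i<n. real (k i)) = real m"
    by (simp only: assms(1)[symmetric] of_nat_sum)
  have "(\<Sum>i<n. (real (k i) / real m - 1 / real n) * x i) =
      (\<Sum>i<n. real (k i) * x i) / real m - \<mu>"
    by (simp add: left_diff_distrib sum_subtractf sum_divide_distrib sample_mean_def \<mu>_def)
  also have "\<dots> = (\<Sum>i<n. real (k i) * (x i - \<mu>)) / real m"
    using assms(2) by (simp add: right_diff_distrib sum_subtractf sum_distrib_right[symmetric] m
        diff_divide_distrib)
  also have "\<dots> / (sample_sd n x / sqrt (real m)) =
      (\<Sum>i<n. real (k i) * (x i - \<mu>)) / (sample_sd n x * (real m / sqrt (real m)))"
    by simp
  also have "real m / sqrt (real m) = sqrt (real m)"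
    by (rule real_div_sqrt) simp
  finally show ?thesis
    by (simp add: boot_T_def \<mu>_def sum_divide_distrib)
qed

lemma sum_deviations:
  assumes "n > 0"
  shows "(\<Sum>i<n. x i - sample_mean n x) = 0"
    and "(\<Sum>i<n. (x i - sample_mean n x)\<^sup>2) = real n * (sample_sd n x)\<^sup>2"
  using assms by (auto simp: sample_mean_def sum_subtractf sample_sd_def sum_nonneg)

text \<open>Second order Taylor expansion of \<open>exp (\<i> s c)\<close>, averaged over a centered sample with second moment
  \<open>1 / m\<close>. One factor of the cubic remainder is bounded by \<open>d\<close>, and the other two are absorbed by the
  second moment.\<close>
lemma mean_iexp_approx:
  fixes c :: "nat \<Rightarrow> real"
  assumes n: "n > 0" and m: "m > 0"
    and c0: "(\<Sum>i<n. c i) = 0" and c2: "(\<Sum>i<n. (c i)\<^sup>2) = real n / real m"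
    and d: "\<And>i. i < n \<Longrightarrow> \<bar>c i\<bar> \<le> d"
  shows "cmod ((\<Sum>i<n. of_real (1 / real n) * iexp (s * c i)) - of_real (1 + (- s\<^sup>2 / 2) / real m))
    \<le> \<bar>s\<bar> ^ 3 * d / 6 / real m"
proof -
  define q where "q i = 1 + \<i> * of_real (s * c i) - of_real ((s * c i)\<^sup>2 / 2)" for i
  have "(\<Sum>i<n. q i) = of_nat n + \<i> * of_real (s * (\<Sum>i<n. c i)) - of_real (s\<^sup>2 * (\<Sum>i<n. (c i)\<^sup>2) / 2)"
    by (simp add: q_def sum.distrib sum_subtractf sum_distrib_left power_mult_distrib sum_divide_distrib)
  also have "\<dots> = of_real (real n * (1 + (- s\<^sup>2 / 2) / real m))"
    by (simp add: c0 c2 field_simps)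
  finally have q: "of_real (1 + (- s\<^sup>2 / 2) / real m) = (\<Sum>i<n. of_real (1 / real n) * q i)"
    using n by (simp only: sum_distrib_left[symmetric] flip: of_real_mult) simp
  have step: "cmod (of_real (1 / real n) * iexp (s * c i) - of_real (1 / real n) * q i)
      \<le> \<bar>s\<bar> ^ 3 * d / 6 / real n * (c i)\<^sup>2" if "i < n" for i
  proof -
    have "(\<Sum>k\<le>2. (\<i> * of_real (s * c i)) ^ k / fact k) = q i"
      by (simp add: q_def numeral_2_eq_2 power2_eq_square algebra_simps)
    then have "cmod (iexp (s * c i) - q i) \<le> \<bar>s * c i\<bar> ^ 3 / 6"
      using iexp_approx1[of "s * c i" 2] by (simp add: fact_numeral)
    also have "\<bar>s * c i\<bar> ^ 3 = \<bar>s\<bar> ^ 3 * (\<bar>c i\<bar> * (c i)\<^sup>2)"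
      by (simp only: abs_mult power_mult_distrib power2_abs[symmetric, of "c i"])
         (simp add: power3_eq_cube power2_eq_square)
    also have "\<bar>s\<bar> ^ 3 * (\<bar>c i\<bar> * (c i)\<^sup>2) / 6 \<le> \<bar>s\<bar> ^ 3 * (d * (c i)\<^sup>2) / 6"
      by (intro divide_right_mono mult_left_mono mult_right_mono d that) auto
    finally have "cmod (iexp (s * c i) - q i) / real n \<le> \<bar>s\<bar> ^ 3 * (d * (c i)\<^sup>2) / 6 / real n"
      by (rule divide_right_mono) simp
    then show ?thesis
      by (simp add: norm_mult norm_divide flip: right_diff_distrib diff_divide_distrib)
  qed
  have "cmod ((\<Sum>i<n. of_real (1 / real n) * iexp (s * c i)) - of_real (1 + (- s\<^sup>2 / 2) / real m))
      \<le> (\<Sum>i<n. \<bar>s\<bar> ^ 3 * d / 6 / real n * (c i)\<^sup>2)"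
    unfolding q sum_subtractf[symmetric] by (intro sum_norm_le step) auto
  also have "\<dots> = \<bar>s\<bar> ^ 3 * d / 6 / real m"
    using n by (simp only: sum_distrib_left[symmetric] c2) simp
  finally show ?thesis .
qed

context prob_space
begin

lemma boot_T_measurable:
  assumes W: "multinomial_distributed M n m p W"
  shows "(\<lambda>\<omega>. boot_T n m x (\<lambda>i. W i \<omega>)) \<in> borel_measurable M"
proof -
  have "W i \<in> measurable M (count_space UNIV)" if "i < n" for i
    using W that by (auto simp: multinomial_distributed_def)
  then have "(\<lambda>\<omega>. real (W i \<omega>)) \<in> borel_measurable M" if "i < n" for i
    using that by (auto intro: measurable_compose[of _ M "count_space UNIV"])
  then show ?thesis
    unfolding boot_T_def
    by (intro borel_measurable_divide borel_measurable_sum borel_measurable_times borel_measurable_diff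
        borel_measurable_const) auto
qed

text \<open>The factors of the multinomial theorem are \<open>exp (\<i> s c i)\<close>: the statistic behaves like a sum of \<open>m\<close>
  independent uniform draws from the rescaled deviations.\<close>
lemma char_boot_T:
  assumes W: "multinomial_distributed M n m (\<lambda>_. 1 / real n) W" and n: "n > 0" and m: "m > 0"
  shows "char (distr M borel (\<lambda>\<omega>. boot_T n m x (\<lambda>i. W i \<omega>))) s =
    (\<Sum>i<n. of_real (1 / real n) *
       iexp (s * ((x i - sample_mean n x) / (sample_sd n x * sqrt (real m))))) ^ m"
proof -
  define c where "c i = (x i - sample_mean n x) / (sample_sd n x * sqrt (real m))" for i
  have T: "iexp (s * boot_T n m x k) = (\<Prod>i<n. iexp (s * c i) ^ k i)"
    if "k \<in> compositions n m" for k
  proof -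
    have "(\<Sum>i<n. k i) = m" using that by (simp add: compositions_def)
    then have "boot_T n m x k = (\<Sum>i<n. real (k i) * c i)"
      unfolding c_def using m n by (rule boot_T_eq_weighted_sum)
    then have "\<i> * of_real (s * boot_T n m x k) = (\<Sum>i<n. of_nat (k i) * (\<i> * of_real (s * c i)))"
      by (simp add: sum_distrib_left mult_ac)
    then show ?thesis
      by (simp add: exp_sum exp_of_nat_mult)
  qed
  have "char (distr M borel (\<lambda>\<omega>. boot_T n m x (\<lambda>i. W i \<omega>))) s =
      (\<integral>\<omega>. iexp (s * boot_T n m x (\<lambda>i. W i \<omega>)) \<partial>M)"
    unfolding char_def by (rule integral_distr) (use boot_T_measurable[OF W] in auto)
  also have "\<dots> = (\<integral>\<omega>. iexp (s * boot_T n m x (restrict (\<lambda>i. W i \<omega>) {..<n})) \<partial>M)"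
    by (simp only: boot_T_restrict)
  also have "\<dots> = (\<Sum>k\<in>compositions n m. multinomial_prob n m (\<lambda>_. 1 / real n) k *\<^sub>R iexp (s * boot_T n m x k))"
    by (rule multinomial_sum_eq_expectation(2)[OF W]) (use n in simp)
  also have "\<dots> = (\<Sum>k\<in>compositions n m. of_real (multinomial_prob n m (\<lambda>_. 1 / real n) k) * (\<Prod>i<n. iexp (s * c i) ^ k i))"
    by (intro sum.cong refl) (simp only: T scaleR_conv_of_real)
  also have "\<dots> = (\<Sum>i<n. of_real (1 / real n) * iexp (s * c i)) ^ m"
    by (rule multinomial_theorem)
  finally show ?thesis
    by (simp only: c_def)
qed

text \<open>An error of order \<open>d / m\<close> in one factor becomes an error of order \<open>d\<close> in the \<open>m\<close>-th power, provided that
  both bases lie in the unit disc. An average of unimodular numbers always does, and the bound on \<open>s\<^sup>2\<close>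
  ensures it for \<open>1 - s\<^sup>2 / (2 m)\<close>.\<close>
lemma char_boot_T_approx:
  assumes W: "multinomial_distributed M n m (\<lambda>_. 1 / real n) W" and n: "n > 0" and m: "m > 0"
    and sd: "sample_sd n x > 0"
    and d: "\<And>i. i < n \<Longrightarrow> \<bar>x i - sample_mean n x\<bar> \<le> d * (sample_sd n x * sqrt (real m))"
    and s: "s\<^sup>2 \<le> 4 * real m"
  shows "cmod (char (distr M borel (\<lambda>\<omega>. boot_T n m x (\<lambda>i. W i \<omega>))) s
      - of_real ((1 + (- s\<^sup>2 / 2) / real m) ^ m)) \<le> \<bar>s\<bar> ^ 3 * d / 6"
proof -
  define c where "c i = (x i - sample_mean n x) / (sample_sd n x * sqrt (real m))" for i
  define z where "z = (\<Sum>i<n. of_real (1 / real n) * iexp (s * c i))"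
  define r where "r = 1 + (- s\<^sup>2 / 2) / real m"
  have pos: "sample_sd n x * sqrt (real m) > 0" using sd m by simp
  have c0: "(\<Sum>i<n. c i) = 0"
    using sum_deviations(1)[OF n, of x] by (simp add: c_def sum_divide_distrib[symmetric])
  have c2: "(\<Sum>i<n. (c i)\<^sup>2) = real n / real m"
    using sum_deviations(2)[OF n, of x] sd
    by (simp add: c_def power_divide power_mult_distrib sum_divide_distrib[symmetric])
  have cd: "\<bar>c i\<bar> \<le> d" if "i < n" for i
    using d[OF that] pos sd by (simp add: c_def abs_divide abs_mult pos_divide_le_eq)
  have "cmod z \<le> (\<Sum>i<n. cmod (of_real (1 / real n) * iexp (s * c i)))"
    unfolding z_def by (rule norm_sum)
  also have "\<dots> = 1"
    using n by (simp add: norm_mult norm_divide)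
  finally have z1: "cmod z \<le> 1" .
  have r1: "cmod (of_real r) \<le> 1"
    using s m by (simp only: norm_of_real) (simp add: r_def abs_le_iff field_simps)
  have "cmod (z ^ m - of_real r ^ m) \<le> real m * cmod (z - of_real r)"
    by (rule norm_power_diff[OF z1 r1])
  also have "\<dots> \<le> real m * (\<bar>s\<bar> ^ 3 * d / 6 / real m)"
    unfolding z_def r_def by (intro mult_left_mono mean_iexp_approx n m c0 c2 cd) auto
  also have "\<dots> = \<bar>s\<bar> ^ 3 * d / 6"
    using m by simp
  finally show ?thesis
    using char_boot_T[OF W n m, of x s] by (simp only: z_def r_def c_def of_real_power)
qed

text \<open>Uniformity over data sets comes from arguing by contradiction: a sequence of ever larger exceptional data
  sets with ever smaller \<open>d\<close> would violate Levy's continuity theorem.\<close>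
lemma boot_T_clt_uniform:
  assumes W: "\<And>n. n \<ge> 1 \<Longrightarrow> multinomial_distributed M n (m n) (\<lambda>_. 1 / real n) (W n)"
    and m: "filterlim m at_top sequentially" and \<eta>: "\<eta> > 0"
  shows "\<exists>d>0. \<exists>N. \<forall>n\<ge>N. \<forall>x. sample_sd n x > 0 \<longrightarrow>
       (\<forall>i<n. \<bar>x i - sample_mean n x\<bar> \<le> d * (sample_sd n x * sqrt (real (m n)))) \<longrightarrow>
       \<bar>prob {\<omega> \<in> space M. boot_T n (m n) x (\<lambda>i. W n i \<omega>) \<le> t} - cdf std_normal_distribution t\<bar> < \<eta>"
proof -
  define Q where "Q d N n x \<longleftrightarrow> n \<ge> N \<and> sample_sd n x > 0 \<and>
       (\<forall>i<n. \<bar>x i - sample_mean n x\<bar> \<le> d * (sample_sd n x * sqrt (real (m n)))) \<and>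
       \<bar>prob {\<omega> \<in> space M. boot_T n (m n) x (\<lambda>i. W n i \<omega>) \<le> t} - cdf std_normal_distribution t\<bar> \<ge> \<eta>"
    for d N n x
  have "\<exists>d>0. \<exists>N. \<forall>n x. \<not> Q d N n x"
  proof (rule ccontr)
    assume "\<not> ?thesis"
    \<comment> \<open>The maximum with \<open>1\<close> keeps the sample size positive, so that the weights are multinomial.\<close>
    then have "\<exists>n x. Q (1 / real (Suc k)) (max 1 k) n x" for k
      by (metis of_nat_0_less_iff zero_less_Suc zero_less_divide_1_iff)
    then obtain \<nu> x where Q: "\<And>k. Q (1 / real (Suc k)) (max 1 k) (\<nu> k) (x k)"
      by metis
    have \<nu>1: "\<nu> k \<ge> 1" "\<nu> k \<ge> k" for k
      using Q[of k] by (auto simp: Q_def)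
    have sd: "sample_sd (\<nu> k) (x k) > 0" for k
      using Q[of k] by (simp add: Q_def)
    have dev: "\<bar>x k i - sample_mean (\<nu> k) (x k)\<bar> \<le> 1 / real (Suc k) * (sample_sd (\<nu> k) (x k) * sqrt (real (m (\<nu> k))))"
      if "i < \<nu> k" for i k
      using Q[of k] that unfolding Q_def by blast
    have "filterlim \<nu> at_top sequentially"
      by (rule filterlim_at_top_mono[OF filterlim_ident]) (auto simp: \<nu>1)
    with m have m\<nu>: "filterlim (\<lambda>k. m (\<nu> k)) at_top sequentially"
      by (rule filterlim_compose)
    define L where "L k = distr M borel (\<lambda>\<omega>. boot_T (\<nu> k) (m (\<nu> k)) (x k) (\<lambda>i. W (\<nu> k) i \<omega>))" for k
    have meas: "(\<lambda>\<omega>. boot_T (\<nu> k) (m (\<nu> k)) (x k) (\<lambda>i. W (\<nu> k) i \<omega>)) \<in> borel_measurable M" for k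
      by (rule boot_T_measurable[OF W[OF \<nu>1(1)]])
    have "weak_conv_m L std_normal_distribution"
    proof (rule levy_continuity)
      show "real_distribution (L k)" for k
        unfolding L_def using meas by (rule real_distribution_distr)
      show "real_distribution std_normal_distribution" by (rule real_dist_normal_dist)
      fix s :: real
      have lim: "(\<lambda>k. complex_of_real ((1 + (- s\<^sup>2 / 2) / real (m (\<nu> k))) ^ m (\<nu> k)))
          \<longlonglongrightarrow> complex_of_real (exp (- s\<^sup>2 / 2))"
        by (intro tendsto_of_real filterlim_compose[OF tendsto_exp_limit_sequentially m\<nu>])
      have "\<forall>\<^sub>F k in sequentially. m (\<nu> k) \<ge> nat \<lceil>s\<^sup>2\<rceil> + 1"
        using m\<nu> by (simp add: filterlim_at_top)
      then have "\<forall>\<^sub>F k in sequentially. cmod (char (L k) s - of_real ((1 + (- s\<^sup>2 / 2) / real (m (\<nu> k))) ^ m (\<nu> k)))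
          \<le> \<bar>s\<bar> ^ 3 * (1 / real (Suc k)) / 6"
      proof eventually_elim
        case (elim k)
        then have "m (\<nu> k) > 0" "s\<^sup>2 \<le> 4 * real (m (\<nu> k))" by linarith+
        moreover have "\<nu> k > 0" using \<nu>1[of k] by simp
        ultimately show ?case
          unfolding L_def by (intro char_boot_T_approx W \<nu>1 sd dev)
      qed
      moreover have "(\<lambda>k. \<bar>s\<bar> ^ 3 * (1 / real (Suc k)) / 6) \<longlonglongrightarrow> 0"
        using LIMSEQ_inverse_real_of_nat
        by (intro tendsto_divide_zero tendsto_mult_right_zero) (simp add: inverse_eq_divide)
      ultimately have "(\<lambda>k. char (L k) s - of_real ((1 + (- s\<^sup>2 / 2) / real (m (\<nu> k))) ^ m (\<nu> k))) \<longlonglongrightarrow> 0"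
        by (rule Lim_null_comparison)
      from Lim_transform[OF lim this]
      show "(\<lambda>k. char (L k) s) \<longlonglongrightarrow> char std_normal_distribution s"
        by (simp add: char_std_normal_distribution)
    qed
    moreover have "isCont (cdf std_normal_distribution) t"
    proof -
      interpret N: real_distribution std_normal_distribution by (rule real_dist_normal_dist)
      have "{t} \<in> null_sets lborel"
        by (intro null_setsI) auto
      then have "emeasure std_normal_distribution {t} = 0"
        by (subst emeasure_density) (auto intro: nn_integral_null_set)
      then show ?thesis
        by (simp add: N.isCont_cdf measure_def)
    qed
    ultimately have "(\<lambda>k. cdf (L k) t) \<longlonglongrightarrow> cdf std_normal_distribution t"
      by (simp add: weak_conv_m_def weak_conv_def)
    then have "\<forall>\<^sub>F k in sequentially. dist (cdf (L k) t) (cdf std_normal_distribution t) < \<eta>"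
      using \<eta> by (rule tendstoD)
    then obtain k where "dist (cdf (L k) t) (cdf std_normal_distribution t) < \<eta>"
      by (auto simp: eventually_sequentially)
    moreover have "cdf (L k) t = prob {\<omega> \<in> space M. boot_T (\<nu> k) (m (\<nu> k)) (x k) (\<lambda>i. W (\<nu> k) i \<omega>) \<le> t}"
      unfolding L_def cdf_def by (subst measure_distr) (auto simp: meas vimage_def Int_def conj_commute)
    ultimately show False
      using Q[of k] by (simp add: Q_def dist_real_def)
  qed
  then show ?thesis
    unfolding Q_def not_le[symmetric] by blast
qed

end

section \<open>Tails and squares from cosines\<close>

text \<open>Taking logarithms: \<open>n (1 - p n)\<close> lies between \<open>p n\<close> times \<open>- ln (p n ^ n)\<close> and \<open>- ln (p n ^ n)\<close> itself, and
  \<open>p n\<close> tends to \<open>1\<close>.\<close>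
lemma tendsto_of_power_tendsto_exp:
  fixes p :: "nat \<Rightarrow> real"
  assumes p: "\<And>n. 0 \<le> p n" "\<And>n. p n \<le> 1" and lim: "(\<lambda>n. p n ^ n) \<longlonglongrightarrow> exp (- a)"
  shows "(\<lambda>n. real n * (1 - p n)) \<longlonglongrightarrow> a"
proof -
  define L where "L n = - ln (p n ^ n)" for n
  have "(\<lambda>n. - ln (p n ^ n)) \<longlonglongrightarrow> - ln (exp (- a))"
    by (intro tendsto_minus tendsto_ln lim) simp
  then have L: "L \<longlonglongrightarrow> a"
    by (simp add: L_def[abs_def])
  have "\<forall>\<^sub>F n in sequentially. p n ^ n > 0"
    using lim by (rule order_tendstoD) simp
  then have pos: "\<forall>\<^sub>F n in sequentially. n > 0 \<and> p n > 0"
    using eventually_gt_at_top[of 0]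
  proof eventually_elim
    case (elim n)
    then have "p n \<noteq> 0" by (auto simp: power_0_left)
    with elim p(1)[of n] show ?case by linarith
  qed
  have L_eq: "L n = - (real n * ln (p n))" if "p n > 0" for n
    using that by (simp add: L_def ln_realpow)
  have "(\<lambda>n. exp (- (L n * (1 / real n)))) \<longlonglongrightarrow> exp (- (a * 0))"
    by (intro tendsto_exp tendsto_minus tendsto_mult L lim_1_over_n)
  then have "(\<lambda>n. exp (- (L n * (1 / real n)))) \<longlonglongrightarrow> 1"
    by simp
  moreover have "\<forall>\<^sub>F n in sequentially. exp (- (L n * (1 / real n))) = p n"
    using pos by eventually_elim (simp add: L_eq)
  ultimately have p1: "p \<longlonglongrightarrow> 1"
    by (rule Lim_transform_eventually)
  have pL: "(\<lambda>n. p n * L n) \<longlonglongrightarrow> a"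
    using tendsto_mult[OF p1 L] by simp
  have lower: "\<forall>\<^sub>F n in sequentially. p n * L n \<le> real n * (1 - p n)"
    using pos
  proof eventually_elim
    case (elim n)
    have "ln (1 / p n) \<le> 1 / p n - 1"
      using elim by (intro ln_le_minus_one) simp
    then have "p n * (- ln (p n)) \<le> 1 - p n"
      using elim by (simp add: ln_div field_simps)
    then have "real n * (p n * (- ln (p n))) \<le> real n * (1 - p n)"
      by (rule mult_left_mono) simp
    then show ?case
      using elim by (simp add: L_eq mult_ac)
  qed
  have upper: "\<forall>\<^sub>F n in sequentially. real n * (1 - p n) \<le> L n"
    using pos
  proof eventually_elim
    case (elim n)
    have "real n * (1 - p n) \<le> real n * (- ln (p n))"
      using ln_le_minus_one[of "p n"] elim by (intro mult_left_mono) auto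
    then show ?case
      using elim by (simp add: L_eq)
  qed
  show ?thesis
    by (rule tendsto_sandwich[OF lower upper pL L])
qed

lemma one_minus_cos_sq: "(1 - cos u)\<^sup>2 = 2 * (1 - cos u) - (1 - cos (2 * u)) / 2" for u :: real
  by (simp only: cos_double_cos) (simp add: power2_eq_square field_simps)

lemma one_minus_cos_sq_le: "(1 - cos u)\<^sup>2 \<le> 4" for u :: real
proof -
  have "(1 - cos u)\<^sup>2 \<le> 2\<^sup>2"
    using cos_ge_minus_one[of u] cos_le_one[of u] by (intro power_mono) auto
  then show ?thesis by simp
qed

lemma abs_one_minus_cos_le: "\<bar>1 - cos u\<bar> \<le> 2" for u :: real
  using cos_ge_minus_one[of u] cos_le_one[of u] by linarith

text \<open>The average over \<open>s\<close> avoids the zeros of \<open>1 - cos (s u)\<close>, which for a single \<open>s\<close> occur at arbitrarily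
  large \<open>u\<close>. The constant part \<open>3 / 2\<close> of \<open>(1 - cos (s u))\<^sup>2\<close> dominates the two oscillating parts
  once \<open>S * \<bar>u\<bar>\<close> is large.\<close>
lemma average_one_minus_cos_sq:
  fixes S u :: real
  assumes S: "S > 0" and u: "S * \<bar>u\<bar> \<ge> 4"
  shows "(\<integral>s. indicator {0..S} s * (1 - cos (s * u))\<^sup>2 \<partial>lborel) \<ge> S / 2"
proof -
  define F where "F s = 3 / 2 * s - 2 * sin (s * u) / u + sin (2 * (s * u)) / (4 * u)" for s
  have u0: "u \<noteq> 0" using u by auto
  have "(F has_real_derivative (1 - cos (s * u))\<^sup>2) (at s)" for s
  proof -
    have "(F has_real_derivative
        3 / 2 * 1 - 2 * (cos (s * u) * (1 * u)) / u + cos (2 * (s * u)) * (2 * (1 * u)) / (4 * u)) (at s)"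
      unfolding F_def
      by (intro DERIV_add DERIV_diff DERIV_cmult DERIV_cdivide DERIV_fun_sin DERIV_cmult_right DERIV_ident)
    also have "3 / 2 * 1 - 2 * (cos (s * u) * (1 * u)) / u + cos (2 * (s * u)) * (2 * (1 * u)) / (4 * u)
        = (1 - cos (s * u))\<^sup>2"
      using u0 unfolding one_minus_cos_sq by (simp add: diff_divide_distrib)
    finally show ?thesis .
  qed
  then have "(\<integral>s. indicator {0..S} s * (1 - cos (s * u))\<^sup>2 \<partial>lborel) = F S - F 0"
    using integral_FTC_Icc_real[of 0 S F "\<lambda>s. (1 - cos (s * u))\<^sup>2"] S
    by (auto simp: mult.commute intro!: continuous_intros)
  also have "F S - F 0 \<ge> S / 2"
  proof -
    have *: "\<bar>y / u\<bar> \<le> S / 4" if "\<bar>y\<bar> \<le> 1" for y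
    proof -
      have "\<bar>y / u\<bar> \<le> 1 / \<bar>u\<bar>" using that u0 by (simp add: abs_divide divide_right_mono)
      also have "\<dots> \<le> S / 4" using u u0 by (simp add: field_simps)
      finally show ?thesis .
    qed
    have F: "F S - F 0 = 3 / 2 * S - 2 * (sin (S * u) / u) + (sin (2 * (S * u)) / u) / 4"
      by (simp add: F_def)
    have "S / 2 \<le> 3 / 2 * S - 2 * y + y' / 4" if "\<bar>y\<bar> \<le> S / 4" "\<bar>y'\<bar> \<le> S / 4" for y y'
      using that S by linarith
    from this[OF *[OF abs_sin_le_one] *[OF abs_sin_le_one]]
    have "S / 2 \<le> 3 / 2 * S - 2 * (sin (S * u) / u) + (sin (2 * (S * u)) / u) / 4" .
    then show ?thesis by (simp only: F)
  qed
  finally show ?thesis .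
qed

context prob_space
begin

lemma integrable_bounded:
  fixes f :: "'a \<Rightarrow> real"
  assumes "f \<in> borel_measurable M" "\<And>\<omega>. \<bar>f \<omega>\<bar> \<le> B"
  shows "integrable M f"
  using assms by (intro integrable_const_bound[of _ B]) auto

lemma integrable_bounded_square:
  fixes f :: "'a \<Rightarrow> real"
  assumes "f \<in> borel_measurable M" "\<And>\<omega>. \<bar>f \<omega>\<bar> \<le> B"
  shows "integrable M (\<lambda>\<omega>. (f \<omega>)\<^sup>2)"
proof (rule integrable_bounded[of _ "B\<^sup>2"])
  show "\<bar>(f \<omega>)\<^sup>2\<bar> \<le> B\<^sup>2" for \<omega>
    using power_mono[OF assms(2)[of \<omega>], of 2] by simp
qed (use assms(1) in measurable)

text \<open>The limit \<open>s\<^sup>2\<close> is quadratic, so the combination of \<open>s\<close> and \<open>2 s\<close> that produces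
  \<open>(1 - cos (s Y / b n))\<^sup>2\<close> cancels. This is where normality of the limit is used: for a stable limit of
  index \<open>\<alpha> < 2\<close> the exponent \<open>\<bar>s\<bar> powr \<alpha>\<close> does not cancel.\<close>
lemma one_minus_cos_sq_negligible:
  assumes [measurable]: "Y \<in> borel_measurable M"
    and lim: "\<And>s. (\<lambda>n. real n * expectation (\<lambda>\<omega>. 1 - cos (s * (Y \<omega> / b n)))) \<longlonglongrightarrow> s\<^sup>2"
  shows "(\<lambda>n. real n * expectation (\<lambda>\<omega>. (1 - cos (s * (Y \<omega> / b n)))\<^sup>2)) \<longlonglongrightarrow> 0"
proof -
  have int: "integrable M (\<lambda>\<omega>. 1 - cos (s * (Y \<omega> / b n)))" for s n
  proof (rule integrable_bounded[of _ 2])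
    show "(\<lambda>\<omega>. 1 - cos (s * (Y \<omega> / b n))) \<in> borel_measurable M" by measurable
  qed (rule abs_one_minus_cos_le)
  have eq: "expectation (\<lambda>\<omega>. (1 - cos (s * (Y \<omega> / b n)))\<^sup>2) =
      2 * expectation (\<lambda>\<omega>. 1 - cos (s * (Y \<omega> / b n))) -
      expectation (\<lambda>\<omega>. 1 - cos (2 * s * (Y \<omega> / b n))) / 2" for n
  proof -
    have "expectation (\<lambda>\<omega>. (1 - cos (s * (Y \<omega> / b n)))\<^sup>2) =
        expectation (\<lambda>\<omega>. 2 * (1 - cos (s * (Y \<omega> / b n))) - (1 - cos (2 * s * (Y \<omega> / b n))) / 2)"
      by (simp only: one_minus_cos_sq mult.assoc)
    also have "\<dots> = expectation (\<lambda>\<omega>. 2 * (1 - cos (s * (Y \<omega> / b n)))) -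
        expectation (\<lambda>\<omega>. (1 - cos (2 * s * (Y \<omega> / b n))) / 2)"
      by (intro Bochner_Integration.integral_diff integrable_mult_right integrable_divide int)
    finally show ?thesis
      by (simp only: integral_mult_right_zero integral_divide_zero)
  qed
  have "(\<lambda>n. 2 * (real n * expectation (\<lambda>\<omega>. 1 - cos (s * (Y \<omega> / b n)))) -
      real n * expectation (\<lambda>\<omega>. 1 - cos (2 * s * (Y \<omega> / b n))) / 2) \<longlonglongrightarrow> 2 * s\<^sup>2 - (2 * s)\<^sup>2 / 2"
    by (intro tendsto_intros lim) simp
  moreover have "2 * s\<^sup>2 - (2 * s)\<^sup>2 / 2 = 0"
    by (simp add: power_mult_distrib)
  moreover have "2 * (c * x) - c * y / 2 = c * (2 * x - y / 2)" for c x y :: real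
    by (simp add: right_diff_distrib)
  ultimately show ?thesis
    by (simp only: eq)
qed

text \<open>Integrating over \<open>s\<close> in \<open>{0..S}\<close> turns \<open>(1 - cos (s Y / b n))\<^sup>2\<close> into a bound for the tail of \<open>Y\<close>. The
  hypothesis is pointwise in \<open>s\<close> and provides no integrable majorant. But the part \<open>e n s\<close> of the expectation
  on the tail event \<open>A n\<close> is at most \<open>4 * prob (A n)\<close>; so if \<open>n * prob (A n) \<ge> \<kappa>\<close>, then
  \<open>e n s / prob (A n)\<close> is at most the minimum of \<open>4\<close> and \<open>n * expectation (k n s) / \<kappa>\<close>, to which dominated
  convergence applies.\<close>
lemma tail_negligible:
  assumes [measurable]: "Y \<in> borel_measurable M" and b: "\<And>n. b n > 0" and \<delta>: "\<delta> > 0"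
    and lim: "\<And>s. (\<lambda>n. real n * expectation (\<lambda>\<omega>. (1 - cos (s * (Y \<omega> / b n)))\<^sup>2)) \<longlonglongrightarrow> 0"
  shows "(\<lambda>n. real n * prob {\<omega> \<in> space M. \<bar>Y \<omega>\<bar> > \<delta> * b n}) \<longlonglongrightarrow> 0"
proof -
  \<comment> \<open>Chosen so that \<open>S * \<bar>u\<bar> \<ge> 4\<close> for all \<open>\<bar>u\<bar> \<ge> \<delta>\<close>.\<close>
  define S where "S = 4 / \<delta>"
  have S: "S > 0" using \<delta> by (simp add: S_def)
  define A where "A n = {\<omega> \<in> space M. \<bar>Y \<omega>\<bar> > \<delta> * b n}" for n
  have [measurable]: "A n \<in> sets M" for n unfolding A_def by measurable
  define P where "P n = real n * prob (A n)" for n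
  define k where "k n s \<omega> = (1 - cos (s * (Y \<omega> / b n)))\<^sup>2" for n s \<omega>
  have k_meas [measurable]: "(\<lambda>(s, \<omega>). k n s \<omega>) \<in> borel_measurable (borel \<Otimes>\<^sub>M M)" for n
    unfolding k_def by measurable
  have k_bounds: "0 \<le> k n s \<omega>" "k n s \<omega> \<le> 4" for n s \<omega>
    by (simp_all add: k_def one_minus_cos_sq_le)
  have k_int: "integrable M (\<lambda>\<omega>. k n s \<omega>)" for n s
    by (rule integrable_bounded[of _ 4]) (use k_bounds in auto)
  have Ek: "0 \<le> expectation (k n s)" for n s
    by (intro integral_nonneg_AE AE_I2 k_bounds)
  define e where "e n s = expectation (\<lambda>\<omega>. indicator (A n) \<omega> * k n s \<omega>)" for n s
  have e_le: "e n s \<le> expectation (k n s)" "e n s \<le> 4 * prob (A n)" for n s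
  proof -
    have i: "integrable M (\<lambda>\<omega>. indicator (A n) \<omega> * k n s \<omega>)"
      by (rule integrable_bounded[of _ 4]) (use k_bounds in \<open>auto simp: indicator_def\<close>)
    show "e n s \<le> expectation (k n s)"
      unfolding e_def by (rule integral_mono[OF i k_int]) (use k_bounds in \<open>auto simp: indicator_def\<close>)
    have "e n s \<le> expectation (\<lambda>\<omega>. 4 * indicator (A n) \<omega>)"
      unfolding e_def
    proof (rule integral_mono[OF i])
      show "integrable M (\<lambda>\<omega>. 4 * indicator (A n) \<omega> :: real)"
        by (rule integrable_bounded[of _ 4]) (auto simp: indicator_def)
    qed (use k_bounds in \<open>auto simp: indicator_def\<close>)
    then show "e n s \<le> 4 * prob (A n)"
      by simp
  qed
  have fubini: "S / 2 * prob (A n) \<le> (\<integral>s. indicator {0..S} s * e n s \<partial>lborel)" for n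
  proof -
    have M: "sigma_finite_measure M" by (rule sigma_finite_measure_axioms)
    interpret pair_sigma_finite lborel M ..
    define f where "f s \<omega> = indicator {0..S} s * (indicator (A n) \<omega> * k n s \<omega>)" for s \<omega>
    have fm [measurable]: "(\<lambda>(s, \<omega>). f s \<omega>) \<in> borel_measurable (lborel \<Otimes>\<^sub>M M)"
      unfolding f_def by measurable
    have i: "integrable (lborel \<Otimes>\<^sub>M M) (\<lambda>(s, \<omega>). f s \<omega>)"
    proof (rule integrableI_bounded_set[where A = "{0..S} \<times> space M" and B = 4])
      show "emeasure (lborel \<Otimes>\<^sub>M M) ({0..S} \<times> space M) < \<infinity>"
        using S by (subst sigma_finite_measure.emeasure_pair_measure_Times[OF M]) (auto simp: emeasure_space_1)
      show "AE x in lborel \<Otimes>\<^sub>M M. x \<in> {0..S} \<times> space M \<longrightarrow> norm (case x of (s, \<omega>) \<Rightarrow> f s \<omega>) \<le> 4"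
        using k_bounds by (auto simp: f_def indicator_def)
      show "AE x in lborel \<Otimes>\<^sub>M M. x \<notin> {0..S} \<times> space M \<longrightarrow> (case x of (s, \<omega>) \<Rightarrow> f s \<omega>) = 0"
        by (rule AE_I2) (auto simp: f_def space_pair_measure indicator_def)
    qed auto
    have "S / 2 * prob (A n) = expectation (\<lambda>\<omega>. S / 2 * indicator (A n) \<omega>)"
      by simp
    also have "\<dots> \<le> expectation (\<lambda>\<omega>. \<integral>s. f s \<omega> \<partial>lborel)"
    proof (rule integral_mono)
      show "integrable M (\<lambda>\<omega>. S / 2 * indicator (A n) \<omega>)"
        by (intro integrable_mult_right integrable_real_indicator) (auto simp: less_top[symmetric])
      show "integrable M (\<lambda>\<omega>. \<integral>s. f s \<omega> \<partial>lborel)"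
        using integrable_snd[OF i] by simp
      fix \<omega> assume \<omega>: "\<omega> \<in> space M"
      show "S / 2 * indicator (A n) \<omega> \<le> (\<integral>s. f s \<omega> \<partial>lborel)"
      proof (cases "\<omega> \<in> A n")
        case True
        then have "\<bar>Y \<omega> / b n\<bar> > \<delta>"
          using b[of n] by (simp add: A_def pos_less_divide_eq)
        then have "S * \<bar>Y \<omega> / b n\<bar> \<ge> S * \<delta>"
          using S by (intro mult_left_mono) auto
        also have "S * \<delta> = 4"
          using \<delta> by (simp add: S_def)
        finally have "S * \<bar>Y \<omega> / b n\<bar> \<ge> 4" .
        from average_one_minus_cos_sq[OF S this] True show ?thesis
          by (simp add: f_def k_def)
      qed (simp add: f_def)
    qed
    also have "\<dots> = (\<integral>s. (\<integral>\<omega>. f s \<omega> \<partial>M) \<partial>lborel)"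
      by (rule Fubini_integral[OF i])
    finally show ?thesis
      by (simp add: f_def e_def)
  qed
  have small: "\<forall>\<^sub>F n in sequentially. P n < \<kappa>" if \<kappa>: "\<kappa> > 0" for \<kappa>
  proof -
    define h where "h n s = indicator {0..S} s * min (real n * expectation (k n s) / \<kappa>) 4" for n s
    have h_meas [measurable]: "h n \<in> borel_measurable lborel" for n
      unfolding h_def by measurable
    have "(\<lambda>n. \<integral>s. h n s \<partial>lborel) \<longlonglongrightarrow> (\<integral>s. 0 \<partial>(lborel :: real measure))"
    proof (rule integral_dominated_convergence[where w = "\<lambda>s. 4 * indicator {0..S} s"])
      show "AE s in lborel. (\<lambda>n. h n s) \<longlonglongrightarrow> 0"
      proof (rule AE_I2)
        fix s
        have "(\<lambda>n. min (real n * expectation (k n s) / \<kappa>) 4) \<longlonglongrightarrow> min (0 / \<kappa>) 4"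
          using lim[of s] \<kappa> unfolding k_def by (intro tendsto_intros) auto
        then show "(\<lambda>n. h n s) \<longlonglongrightarrow> 0"
          unfolding h_def by (intro tendsto_mult_right_zero) simp
      qed
      show "AE s in lborel. norm (h n s) \<le> 4 * indicator {0..S} s" for n
        using \<kappa> Ek by (intro AE_I2) (auto simp: h_def indicator_def)
    qed (use S in auto)
    then have "\<forall>\<^sub>F n in sequentially. (\<integral>s. h n s \<partial>lborel) < S / 2"
      using S by (intro order_tendstoD(2)) auto
    then show ?thesis
    proof eventually_elim
      case (elim n)
      show "P n < \<kappa>"
      proof (rule ccontr)
        assume "\<not> P n < \<kappa>"
        then have P: "P n \<ge> \<kappa>" by simp
        with \<kappa> have "real n * prob (A n) > 0" by (simp add: P_def)
        then have n: "real n > 0" "prob (A n) > 0"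
          by (simp_all add: zero_less_mult_iff)
        have le: "e n s / prob (A n) \<le> min (real n * expectation (k n s) / \<kappa>) 4" for s
        proof -
          have "e n s / prob (A n) \<le> expectation (k n s) / prob (A n)"
            using e_le(1) n by (simp add: divide_right_mono)
          also have "\<dots> = real n * expectation (k n s) / P n"
            using n by (simp add: P_def)
          also have "\<dots> \<le> real n * expectation (k n s) / \<kappa>"
            using P \<kappa> k_bounds by (intro divide_left_mono mult_nonneg_nonneg integral_nonneg_AE) auto
          finally have "e n s / prob (A n) \<le> real n * expectation (k n s) / \<kappa>" .
          moreover have "e n s / prob (A n) \<le> 4"
            using e_le(2)[of n s] n by (simp add: pos_divide_le_eq)
          ultimately show ?thesis by simp
        qed
        have e0: "0 \<le> e n s" for s
          unfolding e_def using k_bounds by (intro integral_nonneg_AE AE_I2) auto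
        have h_int: "integrable lborel (h n)"
        proof (rule Bochner_Integration.integrable_bound[where f = "\<lambda>s. 4 * indicator {0..S} s :: real"])
          show "AE s in lborel. norm (h n s) \<le> norm (4 * indicator {0..S} s :: real)"
            using \<kappa> Ek by (intro AE_I2) (auto simp: h_def indicator_def)
        qed (use S in auto)
        have "S / 2 \<le> (\<integral>s. indicator {0..S} s * e n s \<partial>lborel) / prob (A n)"
          using fubini[of n] n by (simp add: pos_le_divide_eq)
        also have "\<dots> = (\<integral>s. indicator {0..S} s * (e n s / prob (A n)) \<partial>lborel)"
          by simp
        also have "\<dots> \<le> (\<integral>s. h n s \<partial>lborel)"
          using le e0 Ek \<kappa> by (intro integral_mono_AE' h_int AE_I2) (auto simp: h_def indicator_def)
        finally show False using elim by simp
      qed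
    qed
  qed
  have "P \<longlonglongrightarrow> 0"
  proof (rule order_tendstoI)
    fix a :: real assume "a < 0"
    have "0 \<le> P n" for n by (simp add: P_def)
    then show "\<forall>\<^sub>F n in sequentially. a < P n"
      using \<open>a < 0\<close> by (intro always_eventually allI) (rule less_le_trans)
  qed (rule small)
  then show ?thesis by (simp add: P_def[abs_def] A_def)
qed

end

section \<open>Negligible deviations in the domain of attraction of the normal law\<close>

lemma deviation_from_mean_le:
  assumes n: "n > 0" and r: "\<And>i. i < n \<Longrightarrow> \<bar>x i - x 0\<bar> \<le> r" and i: "i < n"
  shows "\<bar>x i - sample_mean n x\<bar> \<le> 2 * r"
proof -
  have "sample_mean n x - x 0 = (\<Sum>j<n. x j - x 0) / real n"
    using n by (simp add: sample_mean_def sum_subtractf diff_divide_distrib)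
  also have "\<bar>\<dots>\<bar> \<le> (\<Sum>j<n. r) / real n"
    unfolding abs_divide abs_of_nat
    by (intro divide_right_mono order.trans[OF sum_abs] sum_mono r) auto
  also have "\<dots> = r" using n by simp
  finally show ?thesis using r[OF i] by linarith
qed

text \<open>The differences over disjoint pairs of observations are independent and free of the centering. Their
  squares bound the sum of squared deviations from below.\<close>
lemma sum_sq_consecutive_differences_le:
  fixes x :: "nat \<Rightarrow> real"
  shows "(\<Sum>i<n div 2. (x (2 * i) - x (2 * i + 1))\<^sup>2) \<le> 2 * (\<Sum>i<n. (x i - c)\<^sup>2)"
proof -
  have sq: "(u - v)\<^sup>2 \<le> 2 * (u - c)\<^sup>2 + 2 * (v - c)\<^sup>2" for u v :: real
  proof -
    have "0 \<le> ((u - c) + (v - c))\<^sup>2" by simp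
    then show ?thesis by (simp add: power2_eq_square algebra_simps)
  qed
  have "(\<Sum>i<k. (x (2 * i) - x (2 * i + 1))\<^sup>2) \<le> 2 * (\<Sum>i<2 * k. (x i - c)\<^sup>2)" for k
  proof (induction k)
    case (Suc k)
    have "(\<Sum>i<2 * Suc k. (x i - c)\<^sup>2) = (\<Sum>i<2 * k. (x i - c)\<^sup>2) + (x (2 * k) - c)\<^sup>2 + (x (2 * k + 1) - c)\<^sup>2"
      by simp
    with Suc sq[of "x (2 * k)" "x (2 * k + 1)"] show ?case by simp
  qed simp
  also have "(\<Sum>i<2 * (n div 2). (x i - c)\<^sup>2) \<le> (\<Sum>i<n. (x i - c)\<^sup>2)"
    by (rule sum_mono2) auto
  finally show ?thesis by simp
qed

context prob_space
begin

lemma second_moment_sum_centered: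
  fixes V :: "'i \<Rightarrow> 'a \<Rightarrow> real"
  assumes "finite I" and "indep_vars (\<lambda>_. borel) V I"
    and "\<And>i \<omega>. i \<in> I \<Longrightarrow> \<bar>V i \<omega>\<bar> \<le> B" and "\<And>i. i \<in> I \<Longrightarrow> expectation (V i) = 0"
  shows "expectation (\<lambda>\<omega>. (\<Sum>i\<in>I. V i \<omega>)\<^sup>2) = (\<Sum>i\<in>I. expectation (\<lambda>\<omega>. (V i \<omega>)\<^sup>2))"
  using assms
proof (induction I rule: finite_induct)
  case (insert i I)
  have V [measurable]: "V j \<in> borel_measurable M" if "j \<in> insert i I" for j
    using insert.prems(1) that by (auto simp: indep_vars_def)
  have B: "\<bar>V j \<omega>\<bar> \<le> B" if "j \<in> insert i I" for j \<omega>
    using insert.prems(2) that by blast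
  define T where "T \<omega> = (\<Sum>j\<in>I. V j \<omega>)" for \<omega>
  have T [measurable]: "T \<in> borel_measurable M"
    unfolding T_def by (intro borel_measurable_sum V) auto
  have TB: "\<bar>T \<omega>\<bar> \<le> real (card I) * B" for \<omega>
    unfolding T_def using B by (intro order.trans[OF sum_abs] sum_bounded_above) auto
  have int_V: "integrable M (V i)"
    by (rule integrable_bounded[of _ B]) (use V B in auto)
  have int_T: "integrable M T"
    by (rule integrable_bounded[OF T TB])
  have int_V2: "integrable M (\<lambda>\<omega>. (V i \<omega>)\<^sup>2)"
    by (rule integrable_bounded_square[of _ B]) (use V B in auto)
  have int_T2: "integrable M (\<lambda>\<omega>. (T \<omega>)\<^sup>2)"
    by (rule integrable_bounded_square[OF T TB])
  have ind: "indep_var borel (V i) borel T"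
    unfolding T_def using insert by (intro indep_vars_sum) auto
  have VT: "expectation (\<lambda>\<omega>. V i \<omega> * T \<omega>) = 0" "integrable M (\<lambda>\<omega>. V i \<omega> * T \<omega>)"
    using indep_var_lebesgue_integral[OF ind int_V int_T] indep_var_integrable[OF ind int_V int_T]
      insert.prems(3)[of i] by auto
  have IH: "expectation (\<lambda>\<omega>. (T \<omega>)\<^sup>2) = (\<Sum>j\<in>I. expectation (\<lambda>\<omega>. (V j \<omega>)\<^sup>2))"
    unfolding T_def using insert.prems by (intro insert.IH indep_vars_subset[OF insert.prems(1)]) auto
  have "expectation (\<lambda>\<omega>. (\<Sum>j\<in>insert i I. V j \<omega>)\<^sup>2) =
      expectation (\<lambda>\<omega>. ((V i \<omega>)\<^sup>2 + (T \<omega>)\<^sup>2) + 2 * (V i \<omega> * T \<omega>))"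
    using insert.hyps by (simp add: T_def power2_sum mult.assoc)
  also have "\<dots> = expectation (\<lambda>\<omega>. (V i \<omega>)\<^sup>2) + expectation (\<lambda>\<omega>. (T \<omega>)\<^sup>2)"
    using int_V2 int_T2 VT by simp
  finally show ?case
    using insert.hyps IH by simp
qed simp

text \<open>Chebyshev's inequality, with the variances bounded by the second moments.\<close>
lemma sum_concentration:
  fixes Z :: "'i \<Rightarrow> 'a \<Rightarrow> real"
  assumes I: "finite I" and ind: "indep_vars (\<lambda>_. borel) Z I"
    and B: "\<And>i \<omega>. i \<in> I \<Longrightarrow> \<bar>Z i \<omega>\<bar> \<le> B" and a: "a > 0"
  shows "prob {\<omega> \<in> space M. \<bar>(\<Sum>i\<in>I. Z i \<omega>) - (\<Sum>i\<in>I. expectation (Z i))\<bar> \<ge> a}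
    \<le> (\<Sum>i\<in>I. expectation (\<lambda>\<omega>. (Z i \<omega>)\<^sup>2)) / a\<^sup>2"
proof -
  define V where "V i \<omega> = Z i \<omega> - expectation (Z i)" for i \<omega>
  have Z [measurable]: "Z i \<in> borel_measurable M" if "i \<in> I" for i
    using ind that by (auto simp: indep_vars_def)
  have int_Z: "integrable M (Z i)" if "i \<in> I" for i
    by (rule integrable_bounded[OF Z B]) (use that in auto)
  have int_Z2: "integrable M (\<lambda>\<omega>. (Z i \<omega>)\<^sup>2)" if "i \<in> I" for i
    by (rule integrable_bounded_square[OF Z B]) (use that in auto)
  have indV: "indep_vars (\<lambda>_. borel) V I"
    unfolding V_def by (rule indep_vars_compose2[OF ind]) auto
  have V0: "expectation (V i) = 0" if "i \<in> I" for i
    using int_Z[OF that] by (simp add: V_def[abs_def] prob_space)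
  have E: "\<bar>expectation (Z i)\<bar> \<le> B" if "i \<in> I" for i
  proof -
    have "\<bar>expectation (Z i)\<bar> \<le> expectation (\<lambda>\<omega>. \<bar>Z i \<omega>\<bar>)" by (rule integral_abs_bound)
    also have "\<dots> \<le> B"
      using B[OF that] int_Z[OF that] by (intro integral_le_const) auto
    finally show ?thesis .
  qed
  have VB: "\<bar>V i \<omega>\<bar> \<le> 2 * B" if "i \<in> I" for i \<omega>
    using E[OF that] B[OF that, of \<omega>] unfolding V_def by linarith
  define T where "T \<omega> = (\<Sum>i\<in>I. V i \<omega>)" for \<omega>
  have Vm: "V i \<in> borel_measurable M" if "i \<in> I" for i
    unfolding V_def using Z[OF that] by measurable
  have T [measurable]: "T \<in> borel_measurable M"
    unfolding T_def by (intro borel_measurable_sum Vm)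
  have TB: "\<bar>T \<omega>\<bar> \<le> real (card I) * (2 * B)" for \<omega>
    unfolding T_def using VB by (intro order.trans[OF sum_abs] sum_bounded_above) auto
  have int_T2: "integrable M (\<lambda>\<omega>. (T \<omega>)\<^sup>2)"
    by (rule integrable_bounded_square[OF T TB])
  have "prob {\<omega> \<in> space M. \<bar>(\<Sum>i\<in>I. Z i \<omega>) - (\<Sum>i\<in>I. expectation (Z i))\<bar> \<ge> a} =
      prob {\<omega> \<in> space M. (T \<omega>)\<^sup>2 \<ge> a\<^sup>2}"
    using a by (simp add: T_def V_def sum_subtractf abs_le_square_iff[symmetric])
  also have "\<dots> \<le> expectation (\<lambda>\<omega>. (T \<omega>)\<^sup>2) / a\<^sup>2"
    using a int_T2 by (intro integral_Markov_inequality_measure[where A = "space M"]) auto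
  also have "expectation (\<lambda>\<omega>. (T \<omega>)\<^sup>2) = (\<Sum>i\<in>I. expectation (\<lambda>\<omega>. (V i \<omega>)\<^sup>2))"
    unfolding T_def by (rule second_moment_sum_centered[OF I indV VB V0])
  also have "(\<Sum>i\<in>I. expectation (\<lambda>\<omega>. (V i \<omega>)\<^sup>2)) \<le> (\<Sum>i\<in>I. expectation (\<lambda>\<omega>. (Z i \<omega>)\<^sup>2))"
    using int_Z int_Z2 by (intro sum_mono) (simp add: V_def variance_eq)
  finally show ?thesis
    by (simp add: divide_right_mono)
qed

text \<open>Symmetrisation: the characteristic function of \<open>X - Y\<close> is the product of that of \<open>X\<close> and its conjugate.\<close>
lemma expectation_cos_difference:
  assumes ind: "indep_var borel X borel Y" and d: "distr M borel X = distr M borel Y"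
  shows "expectation (\<lambda>\<omega>. cos (s * (X \<omega> - Y \<omega>))) = (cmod (char (distr M borel X) s))\<^sup>2"
proof -
  have [measurable]: "X \<in> borel_measurable M" "Y \<in> borel_measurable M"
    using indep_var_rv1[OF ind] indep_var_rv2[OF ind] by auto
  have ind': "indep_var borel X borel (\<lambda>\<omega>. - Y \<omega>)"
    using indep_var_compose[OF ind, of id borel uminus borel] by (simp add: comp_def)
  have neg: "char (distr M borel (\<lambda>\<omega>. - Y \<omega>)) s = cnj (char (distr M borel Y) s)"
  proof -
    have "char (distr M borel (\<lambda>\<omega>. - Y \<omega>)) s = (\<integral>\<omega>. cnj (iexp (s * Y \<omega>)) \<partial>M)"
      unfolding char_def by (subst integral_distr) (auto simp: exp_cnj)
    also have "\<dots> = cnj (\<integral>\<omega>. iexp (s * Y \<omega>) \<partial>M)"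
      by (rule Bochner_Integration.integral_cnj)
    finally show ?thesis
      unfolding char_def by (subst integral_distr) auto
  qed
  have "(\<integral>\<omega>. iexp (s * (X \<omega> - Y \<omega>)) \<partial>M) = char (distr M borel (\<lambda>\<omega>. X \<omega> + - Y \<omega>)) s"
    unfolding char_def by (subst integral_distr) auto
  also have "\<dots> = char (distr M borel X) s * cnj (char (distr M borel X) s)"
    using char_distr_add[OF ind'] neg d by simp
  also have "\<dots> = of_real ((cmod (char (distr M borel X) s))\<^sup>2)"
    by (simp only: complex_norm_square)
  finally have eq: "(\<integral>\<omega>. iexp (s * (X \<omega> - Y \<omega>)) \<partial>M) = \<dots>" .
  have "integrable M (\<lambda>\<omega>. iexp (s * (X \<omega> - Y \<omega>)))"
    by (rule integrable_iexp) auto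
  then have "expectation (\<lambda>\<omega>. Re (iexp (s * (X \<omega> - Y \<omega>)))) = Re (of_real ((cmod (char (distr M borel X) s))\<^sup>2))"
    unfolding eq[symmetric] by (rule integral_Re)
  then show ?thesis
    by (simp add: Re_exp)
qed

lemma iid_seq_indep_var:
  assumes "iid_seq M X" "i \<noteq> j"
  shows "indep_var borel (X i) borel (X j)"
  using assms indep_vars_subset[of "\<lambda>_. borel" X UNIV "{i, j}"]
    indep_vars_sum[of "{j}" i X] unfolding iid_seq_def by simp

text \<open>The normalised sum has characteristic function \<open>exp (- \<i> s a n / b n) * \<phi> (s / b n) ^ n\<close>. Its squared
  modulus forgets the centering \<open>a\<close> and tends to \<open>exp (- s\<^sup>2)\<close>, while \<open>(cmod (\<phi> u))\<^sup>2\<close> is the expectation of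
  \<open>cos\<close> of \<open>u\<close> times a difference of two observations.\<close>
lemma DAN_cos_difference:
  assumes iid: "iid_seq M X" and dan: "DAN M X"
  obtains b where "\<And>n. b n > 0" and
    "\<And>i j s. i \<noteq> j \<Longrightarrow>
       (\<lambda>n. real n * expectation (\<lambda>\<omega>. 1 - cos (s * ((X i \<omega> - X j \<omega>) / b n)))) \<longlonglongrightarrow> s\<^sup>2"
proof -
  from dan obtain a b where b: "\<And>n. b n > 0" and
    conv: "weak_conv_m (\<lambda>n. distr M borel (\<lambda>\<omega>. ((\<Sum>i<n. X i \<omega>) - a n) / b n)) std_normal_distribution"
    unfolding DAN_def by blast
  have ind: "indep_vars (\<lambda>_. borel) X UNIV" and d: "distr M borel (X i) = distr M borel (X 0)" for i
    using iid by (auto simp: iid_seq_def)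
  have X [measurable]: "X i \<in> borel_measurable M" for i
    using ind by (auto simp: indep_vars_def)
  define \<phi> where "\<phi> = char (distr M borel (X 0))"
  interpret D: real_distribution "distr M borel (X 0)"
    by (rule real_distribution_distr) (rule X)
  have char_X: "char (distr M borel (X i)) u = \<phi> u" for i u
    by (simp only: \<phi>_def d[of i])
  have char_S: "cmod (char (distr M borel (\<lambda>\<omega>. ((\<Sum>i<n. X i \<omega>) - a n) / b n)) s) = cmod (\<phi> (s / b n)) ^ n"
    for n s
  proof -
    have "char (distr M borel (\<lambda>\<omega>. ((\<Sum>i<n. X i \<omega>) - a n) / b n)) s =
        (\<integral>\<omega>. iexp (- (s * a n / b n)) * iexp (s / b n * (\<Sum>i<n. X i \<omega>)) \<partial>M)"
      unfolding char_def
      by (subst integral_distr) (auto simp: exp_add[symmetric] diff_divide_distrib algebra_simps)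
    also have "\<dots> = iexp (- (s * a n / b n)) * char (distr M borel (\<lambda>\<omega>. \<Sum>i<n. X i \<omega>)) (s / b n)"
      unfolding char_def by (subst integral_distr) auto
    also have "char (distr M borel (\<lambda>\<omega>. \<Sum>i<n. X i \<omega>)) (s / b n) = \<phi> (s / b n) ^ n"
      using char_distr_sum[OF indep_vars_subset[OF ind, of "{..<n}"], of "s / b n"] by (simp add: char_X)
    finally show ?thesis
      by (simp add: norm_mult norm_power norm_exp_i_times del: of_real_minus of_real_mult of_real_divide)
  qed
  have lim: "(\<lambda>n. ((cmod (\<phi> (s / b n)))\<^sup>2) ^ n) \<longlonglongrightarrow> exp (- s\<^sup>2)" for s
  proof -
    have "(\<lambda>n. char (distr M borel (\<lambda>\<omega>. ((\<Sum>i<n. X i \<omega>) - a n) / b n)) s) \<longlonglongrightarrow> char std_normal_distribution s"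
      by (rule levy_continuity1[OF _ real_dist_normal_dist conv]) (rule real_distribution_distr, measurable)
    then have "(\<lambda>n. (cmod (\<phi> (s / b n)) ^ n)\<^sup>2) \<longlonglongrightarrow> (cmod (char std_normal_distribution s))\<^sup>2"
      unfolding char_S[symmetric] by (intro tendsto_power tendsto_norm)
    moreover have "(cmod (char std_normal_distribution s))\<^sup>2 = exp (- s\<^sup>2)"
      by (simp add: char_std_normal_distribution power2_eq_square exp_add[symmetric])
    ultimately show ?thesis
      by (simp add: power_mult[symmetric] mult.commute)
  qed
  have "(\<lambda>n. real n * expectation (\<lambda>\<omega>. 1 - cos (s * ((X i \<omega> - X j \<omega>) / b n)))) \<longlonglongrightarrow> s\<^sup>2"
    if "i \<noteq> j" for i j s
  proof -
    have E: "expectation (\<lambda>\<omega>. 1 - cos (s * ((X i \<omega> - X j \<omega>) / b n))) = 1 - (cmod (\<phi> (s / b n)))\<^sup>2" for n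
    proof -
      have "expectation (\<lambda>\<omega>. cos (s / b n * (X i \<omega> - X j \<omega>))) = (cmod (\<phi> (s / b n)))\<^sup>2"
        using expectation_cos_difference[OF iid_seq_indep_var[OF iid that], of "s / b n"] d[of i] d[of j]
        by (simp add: \<phi>_def)
      moreover have "integrable M (\<lambda>\<omega>. cos (s / b n * (X i \<omega> - X j \<omega>)))"
        by (rule integrable_bounded[of _ 1]) auto
      ultimately show ?thesis
        by (simp add: prob_space)
    qed
    have "cmod (\<phi> u) \<le> 1" for u
      unfolding \<phi>_def by (rule D.cmod_char_le_1)
    then show ?thesis
      unfolding E by (intro tendsto_of_power_tendsto_exp lim) (auto intro: power_le_one)
  qed
  with b show thesis by (rule that)
qed

lemma iid_pair_differences:
  assumes iid: "iid_seq M X"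
  shows "indep_vars (\<lambda>_. borel) (\<lambda>i \<omega>. X (2 * i) \<omega> - X (2 * i + 1) \<omega>) I"
proof -
  have ind: "indep_vars (\<lambda>_. borel) X UNIV"
    using iid by (simp add: iid_seq_def)
  have "indep_vars (\<lambda>j. Pi\<^sub>M {2 * j, 2 * j + 1} (\<lambda>_. borel :: real measure))
      (\<lambda>j \<omega>. restrict (\<lambda>i. X i \<omega>) {2 * j, 2 * j + 1}) I"
  proof (rule indep_vars_restrict[OF ind])
    have "{2 * j, 2 * j + 1} \<inter> {2 * l, 2 * l + 1} = {}" if "j \<noteq> l" for j l :: nat
      using that by (auto; presburger)
    then show "disjoint_family_on (\<lambda>j. {2 * j, 2 * j + 1}) I"
      by (simp add: disjoint_family_on_def)
  qed simp
  then have "indep_vars (\<lambda>_. borel)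
      (\<lambda>j \<omega>. (\<lambda>x. x (2 * j) - x (2 * j + 1)) (restrict (\<lambda>i. X i \<omega>) {2 * j, 2 * j + 1})) I"
    by (rule indep_vars_compose2) measurable
  then show ?thesis by simp
qed

lemma iid_difference_distr:
  assumes iid: "iid_seq M X" and "i \<noteq> j" "k \<noteq> l"
  shows "distr M borel (\<lambda>\<omega>. X i \<omega> - X j \<omega>) = distr M borel (\<lambda>\<omega>. X k \<omega> - X l \<omega>)"
proof -
  have d: "distr M borel (X i) = distr M borel (X 0)" for i
    using iid by (auto simp: iid_seq_def)
  have "distr M borel (\<lambda>\<omega>. X i \<omega> - X j \<omega>) =
      distr (distr M borel (X 0) \<Otimes>\<^sub>M distr M borel (X 0)) borel (\<lambda>(x, y). x - y)"
    if "i \<noteq> j" for i j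
  proof -
    have ind: "indep_var borel (X i) borel (X j)"
      by (rule iid_seq_indep_var[OF iid that])
    then have [measurable]: "X i \<in> borel_measurable M" "X j \<in> borel_measurable M"
      using indep_var_rv1 indep_var_rv2 by blast+
    have "distr M borel (X 0) \<Otimes>\<^sub>M distr M borel (X 0) = distr M (borel \<Otimes>\<^sub>M borel) (\<lambda>\<omega>. (X i \<omega>, X j \<omega>))"
      using ind d[of i] d[of j] by (simp add: indep_var_distribution_eq)
    then show ?thesis
      by (simp add: distr_distr comp_def)
  qed
  with assms show ?thesis by simp
qed

end

lemma one_minus_cos_le: "1 - cos u \<le> u\<^sup>2 / 2" for u :: real
proof -
  have "1 - cos u = 2 * (sin (u / 2))\<^sup>2"
    using cos_double_sin[of "u / 2"] by simp
  also have "(sin (u / 2))\<^sup>2 \<le> (u / 2)\<^sup>2"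
    by (rule abs_le_square_iff[THEN iffD1]) (rule abs_sin_x_le_abs_x)
  finally show ?thesis by (simp add: power_divide)
qed

text \<open>The deterministic part of the negligibility of the deviations: both sides are compared with \<open>b\<close>. The
  bound on the range gives \<open>\<bar>x i - mean\<bar> \<le> \<delta> * (b / 2)\<close>, and the bound on the cosines gives
  \<open>b / 2 \<le> sd * sqrt n\<close>.\<close>
lemma deviations_le_sd:
  fixes x :: "nat \<Rightarrow> real"
  assumes n: "n > 0" and b: "b > 0" and \<delta>: "\<delta> > 0"
    and range: "\<And>i. i < n \<Longrightarrow> \<bar>x i - x 0\<bar> \<le> \<delta> / 4 * b"
    and Z: "1 / 4 \<le> (\<Sum>i<n div 2. 1 - cos ((x (2 * i) - x (2 * i + 1)) / b))"
  shows "sample_sd n x > 0" and "i < n \<Longrightarrow> \<bar>x i - sample_mean n x\<bar> \<le> \<delta> * (sample_sd n x * sqrt (real n))"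
proof -
  note Z
  also have "(\<Sum>i<n div 2. 1 - cos ((x (2 * i) - x (2 * i + 1)) / b)) \<le>
      (\<Sum>i<n div 2. ((x (2 * i) - x (2 * i + 1)) / b)\<^sup>2 / 2)"
    by (intro sum_mono one_minus_cos_le)
  also have "\<dots> = (\<Sum>i<n div 2. (x (2 * i) - x (2 * i + 1))\<^sup>2) / (2 * b\<^sup>2)"
    by (simp add: power_divide sum_divide_distrib mult.commute)
  also have "\<dots> \<le> 2 * (\<Sum>i<n. (x i - sample_mean n x)\<^sup>2) / (2 * b\<^sup>2)"
    by (intro divide_right_mono sum_sq_consecutive_differences_le) auto
  also have "\<dots> = (sample_sd n x * sqrt (real n))\<^sup>2 / b\<^sup>2"
    by (simp add: sum_deviations(2)[OF n] power_mult_distrib)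
  finally have "(b / 2)\<^sup>2 \<le> (sample_sd n x * sqrt (real n))\<^sup>2"
    using b by (simp add: field_simps)
  moreover have sd0: "0 \<le> sample_sd n x"
    by (simp add: sample_sd_def sum_nonneg)
  ultimately have sd: "b / 2 \<le> sample_sd n x * sqrt (real n)"
    by (intro power2_le_imp_le[of "b / 2" "sample_sd n x * sqrt (real n)"] mult_nonneg_nonneg real_sqrt_ge_zero of_nat_0_le_iff)
  with b have "sample_sd n x \<noteq> 0" by auto
  with sd0 show "sample_sd n x > 0" by simp
  assume "i < n"
  then have "\<bar>x i - sample_mean n x\<bar> \<le> 2 * (\<delta> / 4 * b)"
    using deviation_from_mean_le[of n x "\<delta> / 4 * b" i, OF n range] by blast
  also have "\<dots> = \<delta> * (b / 2)" by simp
  also have "\<dots> \<le> \<delta> * (sample_sd n x * sqrt (real n))"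
    using \<delta> sd by (intro mult_left_mono) auto
  finally show "\<bar>x i - sample_mean n x\<bar> \<le> \<delta> * (sample_sd n x * sqrt (real n))" .
qed

lemma half_over_tendsto: "(\<lambda>n. real (n div 2) / real n) \<longlonglongrightarrow> 1 / 2"
proof (rule tendsto_sandwich)
  show "(\<lambda>n. 1 / 2 - 1 / real n) \<longlonglongrightarrow> 1 / 2"
    using tendsto_diff[OF tendsto_const lim_1_over_n, of "1 / 2"] by simp
  show "\<forall>\<^sub>F n in sequentially. 1 / 2 - 1 / real n \<le> real (n div 2) / real n"
    using eventually_gt_at_top[of 0]
  proof eventually_elim
    case (elim n)
    have "real n \<le> real (2 * (n div 2) + 1)"
      by (subst of_nat_le_iff) presburger
    then have "real n / 2 - 1 \<le> real (n div 2)"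
      by simp
    then have "(real n / 2 - 1) / real n \<le> real (n div 2) / real n"
      by (rule divide_right_mono) simp
    with elim show ?case by (simp add: diff_divide_distrib)
  qed
  show "\<forall>\<^sub>F n in sequentially. real (n div 2) / real n \<le> 1 / 2"
    using eventually_gt_at_top[of 0]
  proof eventually_elim
    case (elim n)
    have "real (n div 2) / real n \<le> (real n / 2) / real n"
    proof (rule divide_right_mono)
      have "real (2 * (n div 2)) \<le> real n"
        by (subst of_nat_le_iff) presburger
      then show "real (n div 2) \<le> real n / 2" by simp
    qed simp
    with elim show ?case by simp
  qed
qed simp

context prob_space
begin

text \<open>Off two events of small probability the deterministic comparison applies. On the first, some observation
  is far from the initial one, which the tail estimate controls by a union bound over \<open>i < n\<close>; on the second,
  the sum of \<open>1 - cos\<close> over disjoint pairs is far from its mean, which tends to \<open>1 / 2\<close>.\<close>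
lemma deviations_negligible:
  assumes iid: "iid_seq M X" and dan: "DAN M X" and \<delta>: "\<delta> > 0"
  shows "(\<lambda>n. prob {\<omega> \<in> space M. \<not> (sample_sd n (\<lambda>i. X i \<omega>) > 0 \<and>
      (\<forall>i<n. \<bar>X i \<omega> - sample_mean n (\<lambda>i. X i \<omega>)\<bar> \<le> \<delta> * (sample_sd n (\<lambda>i. X i \<omega>) * sqrt (real n))))})
    \<longlonglongrightarrow> 0" (is "(\<lambda>n. prob (?bad n)) \<longlonglongrightarrow> 0")
proof -
  obtain b where b: "\<And>n. b n > 0" and
    lim: "\<And>i j s. i \<noteq> j \<Longrightarrow>
       (\<lambda>n. real n * expectation (\<lambda>\<omega>. 1 - cos (s * ((X i \<omega> - X j \<omega>) / b n)))) \<longlonglongrightarrow> s\<^sup>2"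
    using DAN_cos_difference[OF iid dan] by blast
  have X [measurable]: "X i \<in> borel_measurable M" for i
    using iid by (auto simp: iid_seq_def indep_vars_def)
  define Y where "Y \<omega> = X 1 \<omega> - X 0 \<omega>" for \<omega>
  have Y [measurable]: "Y \<in> borel_measurable M"
    unfolding Y_def by measurable
  have distr_Y: "distr M borel (\<lambda>\<omega>. X i \<omega> - X j \<omega>) = distr M borel Y" if "i \<noteq> j" for i j
    using iid_difference_distr[OF iid that, of 1 0] by (simp add: Y_def[abs_def])
  have E_Y: "expectation (\<lambda>\<omega>. f (X i \<omega> - X j \<omega>)) = expectation (\<lambda>\<omega>. f (Y \<omega>))"
    if "i \<noteq> j" and [measurable]: "f \<in> borel_measurable borel" for i j and f :: "real \<Rightarrow> real"
    using arg_cong[OF distr_Y[OF that(1)], of "\<lambda>N. integral\<^sup>L N f"] by (simp add: integral_distr)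
  have lim_Y: "(\<lambda>n. real n * expectation (\<lambda>\<omega>. 1 - cos (s * (Y \<omega> / b n)))) \<longlonglongrightarrow> s\<^sup>2" for s
    using lim[of 1 0 s] by (simp add: Y_def)
  note sq_Y = one_minus_cos_sq_negligible[OF Y lim_Y]
  define P where "P n = real n * prob {\<omega> \<in> space M. \<bar>Y \<omega>\<bar> > \<delta> / 4 * b n}" for n
  have P: "P \<longlonglongrightarrow> 0"
    unfolding P_def using \<delta> by (intro tail_negligible[OF Y b _ sq_Y]) auto
  define Q where "Q n = real n * expectation (\<lambda>\<omega>. (1 - cos (Y \<omega> / b n))\<^sup>2)" for n
  have Q: "Q \<longlonglongrightarrow> 0"
    using sq_Y[of 1] by (simp add: Q_def[abs_def])
  define Z where "Z n i \<omega> = 1 - cos ((X (2 * i) \<omega> - X (2 * i + 1) \<omega>) / b n)" for n i \<omega>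
  have E_Z: "expectation (Z n i) = expectation (\<lambda>\<omega>. 1 - cos (Y \<omega> / b n))" for n i
    unfolding Z_def[abs_def] using E_Y[of "2 * i" "2 * i + 1" "\<lambda>y. 1 - cos (y / b n)"] by simp
  have E_Z2: "expectation (\<lambda>\<omega>. (Z n i \<omega>)\<^sup>2) = expectation (\<lambda>\<omega>. (1 - cos (Y \<omega> / b n))\<^sup>2)" for n i
    unfolding Z_def[abs_def] using E_Y[of "2 * i" "2 * i + 1" "\<lambda>y. (1 - cos (y / b n))\<^sup>2"] by simp
  have indZ: "indep_vars (\<lambda>_. borel) (Z n) I" for n I
    unfolding Z_def[abs_def] by (rule indep_vars_compose2[OF iid_pair_differences[OF iid]]) measurable
  have [measurable]: "Z n i \<in> borel_measurable M" for n i
    unfolding Z_def by measurable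
  define A where "A n i = {\<omega> \<in> space M. \<bar>X i \<omega> - X 0 \<omega>\<bar> > \<delta> / 4 * b n}" for n i
  have A [measurable]: "A n i \<in> sets M" for n i
    unfolding A_def by measurable
  have prob_A: "prob (A n i) \<le> P n / real n" if "n > 0" for n i
  proof (cases "i = 0")
    case True
    have "A n 0 = {}" using \<delta> b[of n] by (auto simp: A_def mult_less_0_iff)
    then show ?thesis using True by (simp add: P_def)
  next
    case False
    have "prob (A n i) = measure (distr M borel (\<lambda>\<omega>. X i \<omega> - X 0 \<omega>)) {y. \<bar>y\<bar> > \<delta> / 4 * b n}"
      by (subst measure_distr) (auto simp: A_def vimage_def Int_def conj_commute)
    also have "\<dots> = prob {\<omega> \<in> space M. \<bar>Y \<omega>\<bar> > \<delta> / 4 * b n}"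
      unfolding distr_Y[OF False] by (subst measure_distr) (auto simp: vimage_def Int_def conj_commute)
    finally show ?thesis using that by (simp add: P_def)
  qed
  define B where "B n = {\<omega> \<in> space M. \<bar>(\<Sum>i<n div 2. Z n i \<omega>) - (\<Sum>i<n div 2. expectation (Z n i))\<bar> \<ge> 1 / 8}" for n
  have B [measurable]: "B n \<in> sets M" for n
    unfolding B_def by measurable
  have prob_B: "prob (B n) \<le> 64 * Q n" for n
  proof -
    have "prob (B n) \<le> (\<Sum>i<n div 2. expectation (\<lambda>\<omega>. (Z n i \<omega>)\<^sup>2)) / (1 / 8)\<^sup>2"
      unfolding B_def
      by (rule sum_concentration[where B = 2, OF _ indZ]) (auto simp: Z_def intro: abs_one_minus_cos_le)
    also have "\<dots> = 64 * (real (n div 2) * expectation (\<lambda>\<omega>. (1 - cos (Y \<omega> / b n))\<^sup>2))"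
      by (simp add: E_Z2 power_divide)
    also have "\<dots> \<le> 64 * Q n"
      unfolding Q_def by (intro mult_left_mono mult_right_mono) auto
    finally show ?thesis .
  qed
  have "(\<lambda>n. real (n div 2) / real n * (real n * expectation (\<lambda>\<omega>. 1 - cos (Y \<omega> / b n)))) \<longlonglongrightarrow> 1 / 2 * 1"
    using lim_Y[of 1] by (intro tendsto_mult half_over_tendsto) simp
  then have "\<forall>\<^sub>F n in sequentially.
      3 / 8 < real (n div 2) / real n * (real n * expectation (\<lambda>\<omega>. 1 - cos (Y \<omega> / b n)))"
    by (rule order_tendstoD) simp
  \<comment> \<open>A mean above \<open>3 / 8\<close> and an error below \<open>1 / 8\<close> give the lower bound \<open>1 / 4\<close>.\<close>
  then have upper: "\<forall>\<^sub>F n in sequentially. prob (?bad n) \<le> P n + 64 * Q n"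
    using eventually_gt_at_top[of 0]
  proof eventually_elim
    case (elim n)
    then have EZ: "3 / 8 < (\<Sum>i<n div 2. expectation (Z n i))"
      by (simp add: E_Z)
    have "?bad n \<subseteq> (\<Union>i<n. A n i) \<union> B n"
    proof
      fix \<omega> assume \<omega>: "\<omega> \<in> ?bad n"
      show "\<omega> \<in> (\<Union>i<n. A n i) \<union> B n"
      proof (rule ccontr)
        assume *: "\<omega> \<notin> (\<Union>i<n. A n i) \<union> B n"
        have 1: "\<bar>X i \<omega> - X 0 \<omega>\<bar> \<le> \<delta> / 4 * b n" if "i < n" for i
          using * that \<omega> by (auto simp: A_def not_less)
        have "\<bar>(\<Sum>i<n div 2. Z n i \<omega>) - (\<Sum>i<n div 2. expectation (Z n i))\<bar> < 1 / 8"
          using * \<omega> by (auto simp: B_def not_le)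
        with EZ have "1 / 4 \<le> (\<Sum>i<n div 2. Z n i \<omega>)" by linarith
        then have 2: "1 / 4 \<le> (\<Sum>i<n div 2. 1 - cos ((X (2 * i) \<omega> - X (2 * i + 1) \<omega>) / b n))"
          by (simp only: Z_def)
        show False
          using \<omega> deviations_le_sd[of n "b n" \<delta> "\<lambda>i. X i \<omega>", OF elim(2) b \<delta> 1 2] by blast
      qed
    qed
    then have "prob (?bad n) \<le> prob ((\<Union>i<n. A n i) \<union> B n)"
      by (rule finite_measure_mono) measurable
    also have "\<dots> \<le> prob (\<Union>i<n. A n i) + prob (B n)"
      by (rule measure_Un_le) measurable
    also have "prob (\<Union>i<n. A n i) \<le> (\<Sum>i<n. prob (A n i))"
      by (rule finite_measure_subadditive_finite) auto
    also have "\<dots> \<le> (\<Sum>i<n. P n / real n)"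
      using elim by (intro sum_mono prob_A) auto
    also have "\<dots> = P n" using elim by simp
    finally show ?case using prob_B[of n] by linarith
  qed
  have PQ: "(\<lambda>n. P n + 64 * Q n) \<longlonglongrightarrow> 0"
    using tendsto_add[OF P tendsto_mult_right_zero[OF Q, of 64]] by simp
  show ?thesis
    by (rule tendsto_sandwich[OF _ upper tendsto_const PQ]) simp
qed

end

section \<open>Conditional probabilities given the data\<close>

lemma sigma_first_measurable:
  "(\<lambda>\<omega>. \<lambda>i\<in>{..<n}. Y i \<omega>) \<in> measurable (sigma_first M Y n) (Pi\<^sub>M {..<n} (\<lambda>_. borel))"
  unfolding sigma_first_def by (rule measurable_vimage_algebra1) (auto simp: space_PiM)

lemma sigma_first_measurable_component:
  assumes "i < n"
  shows "Y i \<in> borel_measurable (sigma_first M Y n)"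
proof -
  have "(\<lambda>\<omega>. (\<lambda>i\<in>{..<n}. Y i \<omega>) i) \<in> borel_measurable (sigma_first M Y n)"
    by (rule measurable_compose[OF sigma_first_measurable measurable_component_singleton]) (use assms in simp)
  then show ?thesis using assms by simp
qed

lemma subalgebra_sigma_first:
  assumes "\<And>i. i < n \<Longrightarrow> Y i \<in> borel_measurable M"
  shows "subalgebra M (sigma_first M Y n)"
proof -
  have "(\<lambda>\<omega>. \<lambda>i\<in>{..<n}. Y i \<omega>) \<in> measurable M (Pi\<^sub>M {..<n} (\<lambda>_. borel))"
    using assms by (intro measurable_restrict) auto
  then have "sets (sigma_first M Y n) \<subseteq> sets M"
    unfolding sigma_first_def by (subst sets_vimage_algebra2) (auto simp: space_PiM intro: measurable_sets)
  then show ?thesis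
    by (simp add: subalgebra_def sigma_first_def)
qed

text \<open>Events that depend on the data alone are cylinders over the data space.\<close>
lemma sigma_first_section_constant:
  assumes A: "A \<in> sets (sigma_first (M \<Otimes>\<^sub>M N) (\<lambda>i z. X i (fst z)) n)"
    and "u \<in> space M" "v \<in> space N" "v' \<in> space N"
  shows "(u, v) \<in> A \<longleftrightarrow> (u, v') \<in> A"
proof -
  have "(\<lambda>z. \<lambda>i\<in>{..<n}. X i (fst z)) \<in> space (M \<Otimes>\<^sub>M N) \<rightarrow> space (Pi\<^sub>M {..<n} (\<lambda>_. borel :: real measure))"
    by (auto simp: space_PiM)
  from A[unfolded sigma_first_def sets_vimage_algebra2[OF this]] assms(2-)
  show ?thesis by (auto simp: space_pair_measure)
qed

lemma sigma_first_measurable_section_constant: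
  assumes f: "f \<in> borel_measurable (sigma_first (M \<Otimes>\<^sub>M N) (\<lambda>i z. X i (fst z)) n)"
    and u: "u \<in> space M" "v \<in> space N" "v' \<in> space N"
  shows "f (u, v) = (f (u, v') :: real)"
proof -
  let ?F = "sigma_first (M \<Otimes>\<^sub>M N) (\<lambda>i z. X i (fst z)) n"
  have "f -` {f (u, v')} \<inter> space ?F \<in> sets ?F"
    using f by (rule measurable_sets) simp
  from sigma_first_section_constant[OF this u] u show ?thesis
    by (simp add: sigma_first_def space_pair_measure)
qed

lemma (in prob_space) prob_boot_T_le_eq_sum:
  assumes W: "multinomial_distributed M n m (\<lambda>_. 1 / real n) W" and n: "n > 0"
  shows "prob {\<omega> \<in> space M. boot_T n m x (\<lambda>i. W i \<omega>) \<le> t} =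
    (\<Sum>k\<in>compositions n m. multinomial_prob n m (\<lambda>_. 1 / real n) k * indicator {..t} (boot_T n m x k))"
proof -
  have "{\<omega> \<in> space M. boot_T n m x (\<lambda>i. W i \<omega>) \<le> t} \<in> sets M"
    using boot_T_measurable[OF W] by measurable
  then have "prob {\<omega> \<in> space M. boot_T n m x (\<lambda>i. W i \<omega>) \<le> t} =
      expectation (indicator {\<omega> \<in> space M. boot_T n m x (\<lambda>i. W i \<omega>) \<le> t})"
    by simp
  also have "\<dots> = expectation (\<lambda>\<omega>. indicator {..t} (boot_T n m x (restrict (\<lambda>i. W i \<omega>) {..<n})))"
    by (intro Bochner_Integration.integral_cong) (auto simp: boot_T_restrict indicator_def)
  also have "\<dots> = (\<Sum>k\<in>compositions n m. multinomial_prob n m (\<lambda>_. 1 / real n) k * indicator {..t} (boot_T n m x k))"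
    using multinomial_sum_eq_expectation(2)[OF W, where g = "\<lambda>k. indicator {..t} (boot_T n m x k) :: real"] n by simp
  finally show ?thesis .
qed

text \<open>The right-hand side is measurable in the data because it is a finite sum over weight vectors. It has the
  defining integrals of the conditional probability by Fubini's theorem, since an event of the data does not
  restrict the weights. Both sides being independent of the second coordinate, an almost sure identity on the
  product space holds for almost all data at the fixed coordinate \<open>v\<close>.\<close>
lemma boot_cond_prob_eq:
  fixes PX :: "'x measure" and Pw :: "'w measure"
  assumes "prob_space PX" and "prob_space Pw"
    and X: "\<And>i. X i \<in> borel_measurable PX" and n: "n \<ge> 1"
    and W: "multinomial_distributed Pw n (m n) (\<lambda>_. 1 / real n) (w n)" and v: "v \<in> space Pw"
  shows "AE u in PX. boot_cond_prob PX Pw X w m t n (u, v) =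
    measure Pw {\<omega> \<in> space Pw. boot_T n (m n) (\<lambda>i. X i u) (\<lambda>i. w n i \<omega>) \<le> t}"
proof -
  interpret PX: prob_space PX by fact
  interpret Pw: prob_space Pw by fact
  interpret PP: pair_prob_space PX Pw ..
  let ?P = "PX \<Otimes>\<^sub>M Pw"
  define F where "F = sigma_first ?P (\<lambda>i z. X i (fst z)) n"
  define T where "T z = boot_T n (m n) (\<lambda>i. X i (fst z)) (\<lambda>i. w n i (snd z))" for z
  define E where "E = {z \<in> space ?P. T z \<le> t}"
  define G where "G u = measure Pw {\<omega> \<in> space Pw. boot_T n (m n) (\<lambda>i. X i u) (\<lambda>i. w n i \<omega>) \<le> t}" for u
  have sub: "subalgebra ?P F"
    unfolding F_def by (rule subalgebra_sigma_first) (use X in measurable)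
  interpret finite_measure_subalgebra ?P F
    by unfold_locales (rule sub)
  have boot_meas: "(\<lambda>z. boot_T n (m n) (x z) (k z)) \<in> borel_measurable N"
    if "\<And>i. i < n \<Longrightarrow> (\<lambda>z. x z i) \<in> borel_measurable N" "\<And>i. i < n \<Longrightarrow> (\<lambda>z. real (k z i)) \<in> borel_measurable N"
    for x :: "'z \<Rightarrow> nat \<Rightarrow> real" and k and N :: "'z measure"
    unfolding boot_T_def sample_sd_def sample_mean_def using that
    by (intro borel_measurable_divide borel_measurable_sum borel_measurable_times borel_measurable_diff
        borel_measurable_const borel_measurable_power borel_measurable_sqrt) auto
  have "w n i \<in> measurable Pw (count_space UNIV)" if "i < n" for i
    using W that by (auto simp: multinomial_distributed_def)
  then have w: "(\<lambda>z. real (w n i (snd z))) \<in> borel_measurable ?P" if "i < n" for i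
    using that by measurable
  have T: "T \<in> borel_measurable ?P"
    unfolding T_def by (rule boot_meas) (use X w in measurable)
  then have E [measurable]: "E \<in> sets ?P"
    unfolding E_def by measurable
  have G_F: "(\<lambda>z. G (fst z)) \<in> borel_measurable F"
  proof -
    have "(\<lambda>z. boot_T n (m n) (\<lambda>i. X i (fst z)) k) \<in> borel_measurable F" for k
      unfolding F_def by (rule boot_meas) (auto intro: sigma_first_measurable_component)
    then show ?thesis
      unfolding G_def Pw.prob_boot_T_le_eq_sum[OF W less_le_trans[OF zero_less_one n]]
      by (intro borel_measurable_sum borel_measurable_times borel_measurable_const
          measurable_compose[OF _ borel_measurable_indicator]) auto
  qed
  then have G_P: "(\<lambda>z. G (fst z)) \<in> borel_measurable ?P"
    by (rule measurable_from_subalg[OF sub])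
  have G_bound: "\<bar>G u\<bar> \<le> 1" for u
    by (simp add: G_def)
  have G_section: "(\<integral>\<omega>. indicator E (u, \<omega>) \<partial>Pw) = G u" if "u \<in> space PX" for u
  proof -
    have "(\<integral>\<omega>. indicator E (u, \<omega>) \<partial>Pw) =
        (\<integral>\<omega>. indicator {\<omega> \<in> space Pw. boot_T n (m n) (\<lambda>i. X i u) (\<lambda>i. w n i \<omega>) \<le> t} \<omega> \<partial>Pw)"
      using that by (intro Bochner_Integration.integral_cong)
        (auto simp: E_def T_def space_pair_measure indicator_def)
    also have "\<dots> = G u"
      unfolding G_def using Pw.boot_T_measurable[OF W] by simp
    finally show ?thesis .
  qed
  have "AE z in ?P. real_cond_exp ?P F (indicator E) z = G (fst z)"
  proof (rule real_cond_exp_charact[OF _ _ _ G_F])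
    show "integrable ?P (indicator E :: _ \<Rightarrow> real)"
      by (rule PP.integrable_bounded[of _ 1]) (auto simp: indicator_def)
    show "integrable ?P (\<lambda>z. G (fst z))"
      by (rule PP.integrable_bounded[OF G_P G_bound])
    fix A assume A: "A \<in> sets F"
    then have A_P [measurable]: "A \<in> sets ?P"
      using sub by (auto simp: subalgebra_def)
    have A_section: "indicator A (u, \<omega>) = (indicator A (u, v) :: real)"
      if "u \<in> space PX" "\<omega> \<in> space Pw" for u \<omega>
      using sigma_first_section_constant[OF A[unfolded F_def] that v] by (simp add: indicator_def)
    have "integrable ?P (\<lambda>z. indicator A z * indicator E z :: real)"
      by (rule PP.integrable_bounded[of _ 1]) (auto simp: indicator_def)
    then have "(\<integral>z\<in>A. (indicator E z :: real) \<partial>?P) = (\<integral>u. (\<integral>\<omega>. (indicator A (u, \<omega>) * indicator E (u, \<omega>) :: real) \<partial>Pw) \<partial>PX)"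
      unfolding set_lebesgue_integral_def real_scaleR_def by (rule PP.integral_fst'[symmetric])
    also have "\<dots> = (\<integral>u. indicator A (u, v) * G u \<partial>PX)"
    proof (rule Bochner_Integration.integral_cong[OF refl])
      fix u assume u: "u \<in> space PX"
      have "(\<integral>\<omega>. (indicator A (u, \<omega>) * indicator E (u, \<omega>) :: real) \<partial>Pw) = (\<integral>\<omega>. (indicator A (u, v) * indicator E (u, \<omega>) :: real) \<partial>Pw)"
        by (intro Bochner_Integration.integral_cong refl) (simp only: A_section[OF u])
      also have "\<dots> = indicator A (u, v) * G u"
        using G_section[OF u] by simp
      finally show "(\<integral>\<omega>. (indicator A (u, \<omega>) * indicator E (u, \<omega>) :: real) \<partial>Pw) = indicator A (u, v) * G u" .
    qed
    also have "\<dots> = (\<integral>u. (\<integral>\<omega>. indicator A (u, \<omega>) * G u \<partial>Pw) \<partial>PX)"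
    proof (rule Bochner_Integration.integral_cong[OF refl])
      fix u assume u: "u \<in> space PX"
      have "(\<integral>\<omega>. indicator A (u, \<omega>) * G u \<partial>Pw) = (\<integral>\<omega>. indicator A (u, v) * G u \<partial>Pw)"
        by (intro Bochner_Integration.integral_cong refl) (simp only: A_section[OF u])
      also have "\<dots> = indicator A (u, v) * G u"
        using Pw.prob_space by simp
      finally show "indicator A (u, v) * G u = (\<integral>\<omega>. indicator A (u, \<omega>) * G u \<partial>Pw)" ..
    qed
    also have "\<dots> = (\<integral>z\<in>A. G (fst z) \<partial>?P)"
    proof -
      have "integrable ?P (\<lambda>z. indicator A z * G (fst z))"
        by (rule PP.integrable_bounded[of _ 1]) (use G_P G_bound in \<open>auto simp: indicator_def\<close>)
      from PP.integral_fst'[OF this] show ?thesis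
        unfolding set_lebesgue_integral_def real_scaleR_def by simp
    qed
    finally show "(\<integral>z\<in>A. (indicator E z :: real) \<partial>?P) = (\<integral>z\<in>A. G (fst z) \<partial>?P)" .
  qed
  then have "AE u in PX. AE \<omega> in Pw. real_cond_exp ?P F (indicator E) (u, \<omega>) = G u"
    using PP.AE_pair by fastforce
  then have "AE u in PX. real_cond_exp ?P F (indicator E) (u, v) = G u"
    using AE_space
  proof eventually_elim
    case (elim u)
    note u = elim(2)
    from elim(1) have "AE \<omega> in Pw. real_cond_exp ?P F (indicator E) (u, v) = G u"
      using AE_space
    proof eventually_elim
      case (elim \<omega>)
      have "real_cond_exp ?P F (indicator E) \<in> borel_measurable (sigma_first ?P (\<lambda>i z. X i (fst z)) n)"
        using borel_measurable_cond_exp[of ?P F "indicator E"] by (simp only: F_def)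
      from sigma_first_measurable_section_constant[OF this u v elim(2)] elim(1)
      show ?case by simp
    qed
    then show ?case by simp
  qed
  then show ?thesis
    by (simp add: boot_cond_prob_def cond_prob_given_def E_def T_def F_def G_def)
qed

section \<open>Convergence in probability of the bootstrap distribution\<close>

theorem theorem3p2:
  fixes PX :: "'x measure" and Pw :: "'w measure"
    and X :: "nat \<Rightarrow> 'x \<Rightarrow> real" and w :: "nat \<Rightarrow> nat \<Rightarrow> 'w \<Rightarrow> nat"
    and m :: "nat \<Rightarrow> nat" and \<epsilon> :: real
  assumes "prob_space PX" and "prob_space Pw"
    and "iid_seq PX X" and "DAN PX X"
    and "\<And>n. n \<ge> 1 \<Longrightarrow> multinomial_distributed Pw n (m n) (\<lambda>_. 1 / real n) (w n)"
    and "filterlim m at_top sequentially"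
    and "\<epsilon> > 0" and "\<And>n. n \<ge> 1 \<Longrightarrow> real (m n) / real n \<ge> \<epsilon>"
  shows "\<forall>t. conv_in_prob_fst PX Pw (boot_cond_prob PX Pw X w m t)
               (cdf std_normal_distribution t)"
proof (unfold conv_in_prob_fst_def conv_in_prob_def, intro allI ballI conjI impI)
  fix t v assume v: "v \<in> space Pw"
  interpret PX: prob_space PX by fact
  interpret Pw: prob_space Pw by fact
  have "PX.indep_vars (\<lambda>_. borel) X UNIV"
    using assms(3) by (simp only: iid_seq_def)
  then have X: "X i \<in> borel_measurable PX" for i
    by (simp add: PX.indep_vars_def)
  have "boot_cond_prob PX Pw X w m t n \<in> borel_measurable (PX \<Otimes>\<^sub>M Pw)" for n
    unfolding boot_cond_prob_def cond_prob_given_def by (rule borel_measurable_cond_exp2)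
  from measurable_compose[OF measurable_Pair2'[OF v] this]
  show "(\<lambda>u. boot_cond_prob PX Pw X w m t n (u, v)) \<in> borel_measurable PX" for n .
  fix \<eta> :: real assume \<eta>: "\<eta> > 0"
  obtain d N where d: "d > 0" and clt:
    "\<And>n x. n \<ge> N \<Longrightarrow> sample_sd n x > 0 \<Longrightarrow>
       (\<And>i. i < n \<Longrightarrow> \<bar>x i - sample_mean n x\<bar> \<le> d * (sample_sd n x * sqrt (real (m n)))) \<Longrightarrow>
       \<bar>measure Pw {\<omega> \<in> space Pw. boot_T n (m n) x (\<lambda>i. w n i \<omega>) \<le> t} - cdf std_normal_distribution t\<bar> < \<eta>"
    using Pw.boot_T_clt_uniform[where t = t, OF assms(5,6) \<eta>] by blast
  \<comment> \<open>The factor \<open>sqrt \<epsilon>\<close> passes from \<open>sqrt n\<close> to \<open>sqrt (m n)\<close>.\<close>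
  define \<delta> where "\<delta> = d * sqrt \<epsilon>"
  have \<delta>: "\<delta> > 0" using d \<open>\<epsilon> > 0\<close> by (simp add: \<delta>_def)
  define bad where "bad n = {u \<in> space PX. \<not> (sample_sd n (\<lambda>i. X i u) > 0 \<and>
      (\<forall>i<n. \<bar>X i u - sample_mean n (\<lambda>i. X i u)\<bar> \<le> \<delta> * (sample_sd n (\<lambda>i. X i u) * sqrt (real n))))}" for n
  have lim: "(\<lambda>n. measure PX (bad n)) \<longlonglongrightarrow> 0"
    unfolding bad_def by (rule PX.deviations_negligible[OF assms(3,4) \<delta>])
  have bad [measurable]: "bad n \<in> sets PX" for n
    unfolding bad_def sample_sd_def sample_mean_def using X by measurable
  have "\<forall>\<^sub>F n in sequentially. measure PX {u \<in> space PX.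
      \<bar>boot_cond_prob PX Pw X w m t n (u, v) - cdf std_normal_distribution t\<bar> > \<eta>} \<le> measure PX (bad n)"
    using eventually_ge_at_top[of "max 1 N"]
  proof eventually_elim
    case (elim n)
    then have n: "n \<ge> 1" "n \<ge> N" by auto
    have "AE u in PX. u \<in> {u \<in> space PX.
        \<bar>boot_cond_prob PX Pw X w m t n (u, v) - cdf std_normal_distribution t\<bar> > \<eta>} \<longrightarrow> u \<in> bad n"
      using boot_cond_prob_eq[where t = t and X = X and m = m and w = w, OF assms(1,2) X n(1) assms(5)[OF n(1)] v] AE_space
    proof eventually_elim
      case (elim u)
      show ?case
      proof (intro impI, rule ccontr)
        assume u: "u \<in> {u \<in> space PX.
          \<bar>boot_cond_prob PX Pw X w m t n (u, v) - cdf std_normal_distribution t\<bar> > \<eta>}" and "u \<notin> bad n"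
        with elim have sd: "sample_sd n (\<lambda>i. X i u) > 0" and
          dev: "\<And>i. i < n \<Longrightarrow> \<bar>X i u - sample_mean n (\<lambda>i. X i u)\<bar> \<le> \<delta> * (sample_sd n (\<lambda>i. X i u) * sqrt (real n))"
          by (auto simp: bad_def)
        have "\<epsilon> * real n \<le> real (m n)"
          using assms(8)[OF n(1)] n(1) by (simp add: pos_le_divide_eq)
        then have "sqrt \<epsilon> * sqrt (real n) \<le> sqrt (real (m n))"
          by (simp flip: real_sqrt_mult)
        then have "d * sample_sd n (\<lambda>i. X i u) * (sqrt \<epsilon> * sqrt (real n)) \<le>
            d * sample_sd n (\<lambda>i. X i u) * sqrt (real (m n))"
          using d sd by (intro mult_left_mono) auto
        then have "\<delta> * (sample_sd n (\<lambda>i. X i u) * sqrt (real n)) \<le> d * (sample_sd n (\<lambda>i. X i u) * sqrt (real (m n)))"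
          by (simp add: \<delta>_def mult_ac)
        with dev have "\<bar>X i u - sample_mean n (\<lambda>i. X i u)\<bar> \<le> d * (sample_sd n (\<lambda>i. X i u) * sqrt (real (m n)))"
          if "i < n" for i using that order.trans by blast
        from clt[OF n(2) sd this] u elim show False by simp
      qed
    qed
    then show ?case
      by (rule PX.finite_measure_mono_AE) (rule bad)
  qed
  then show "(\<lambda>n. measure PX {u \<in> space PX.
      \<bar>boot_cond_prob PX Pw X w m t n (u, v) - cdf std_normal_distribution t\<bar> > \<eta>}) \<longlonglongrightarrow> 0"
    by (rule tendsto_sandwich[OF _ _ tendsto_const lim, rotated]) simp
qed

end
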